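(* Let $r\ge 3$ and $k\ge 3$ be integers and let $t=\lceil (r-2)(3r+1)/6\rceil$. If $k\le t+1$, then $i_k(K_r^-)$ is attained by $W[\frac1{k-1},\ldots,\frac1{k-1}]$ (with $k-1$ parts). If $k>t+1$, then $i_k(K_r^-)$ is attained by $W[\frac1t,\ldots,\frac1t]$ (with $t$ parts).
   Context: All graphs are finite and simple. $K_r^-$ is the complete graph on $r$ vertices with one edge removed. For graphs $F,G$, $P(F,G)$ is the number of $|V(F)|$-subsets of $V(G)$ inducing a subgraph isomorphic to $F$, and $p(F,G)=P(F,G)/\binom{|V(G)|}{|V(F)|}$. $i_k(F,n)$ is the maximum of $p(F,G)$ over all $n$-vertex graphs $G$ not containing $K_k$ as a subgraph, and $i_k(F)=\lim_{n\to\infty}i_k(F,n)$ (the limit exists). For $x_1,\ldots,x_\ell>0$ with $\sum x_i=1$, the complete $\ell$-partite graphon $W[x_1,\ldots,x_\ell]:[0,1]^2\to\{0,1\}$ is obtained by partitioning $[0,1]$ into intervals of lengths $x_1,\ldots,x_\ell$ and setting $W(x,y)=1$ iff $x,y$ lie in distinct intervals. The induced density of $F$ in $W$ is the probability that $|V(F)|$ independent uniform points of $[0,1]$ induce a copy of $F$, where distinct $u,v$ are adjacent iff $W(u,v)=1$. $i_k(F)$ is attained by $W$ if the induced density of $F$ in $W$ equals $i_k(F)$. *)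

theory Defs
  imports "HOL-Probability.Probability"
begin

type_synonym 'a graph = "'a set \<times> 'a set set"

abbreviation verts :: "'a graph \<Rightarrow> 'a set" where "verts G \<equiv> fst G"
abbreviation edges :: "'a graph \<Rightarrow> 'a set set" where "edges G \<equiv> snd G"

definition simple_graph :: "'a graph \<Rightarrow> bool" where
  "simple_graph G \<longleftrightarrow> finite (verts G) \<and> edges G \<subseteq> {e. e \<subseteq> verts G \<and> card e = 2}"

text \<open>The singleton \<open>{u, u}\<close> is never an edge of a simple graph, so no \<open>u \<noteq> v\<close> guard is needed below.\<close>

definition graph_iso :: "'a graph \<Rightarrow> 'b graph \<Rightarrow> bool" where
  "graph_iso F G \<longleftrightarrow> (\<exists>f. bij_betw f (verts F) (verts G) \<and>
     (\<forall>u\<in>verts F. \<forall>v\<in>verts F. {u, v} \<in> edges F \<longleftrightarrow> {f u, f v} \<in> edges G))"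

definition induced_subgraph :: "'a graph \<Rightarrow> 'a set \<Rightarrow> 'a graph" where
  "induced_subgraph G S = (S, {e \<in> edges G. e \<subseteq> S})"

definition contains_subgraph :: "'a graph \<Rightarrow> 'b graph \<Rightarrow> bool" where
  "contains_subgraph G F \<longleftrightarrow> (\<exists>f. inj_on f (verts F) \<and> f ` verts F \<subseteq> verts G \<and>
     (\<forall>e\<in>edges F. f ` e \<in> edges G))"

definition complete_simple_graph :: "nat \<Rightarrow> nat graph" where
  "complete_simple_graph r = ({..<r}, {e. e \<subseteq> {..<r} \<and> card e = 2})"

definition complete_minus_edge :: "nat \<Rightarrow> nat graph" where
  "complete_minus_edge r = ({..<r}, edges (complete_simple_graph r) - {{0, 1}})"

definition induced_count :: "'a graph \<Rightarrow> 'b graph \<Rightarrow> nat" where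
  "induced_count F G = card {S. S \<subseteq> verts G \<and> card S = card (verts F) \<and>
     graph_iso F (induced_subgraph G S)}"

definition induced_density :: "'a graph \<Rightarrow> 'b graph \<Rightarrow> real" where
  "induced_density F G =
     real (induced_count F G) / real (card (verts G) choose card (verts F))"

text \<open>Every finite graph is isomorphic to one with vertices in \<^typ>\<open>nat\<close>. The set of values under
  \<^const>\<open>Max\<close> is finite, since each value has a numerator bounded in terms of \<open>n\<close>, and it is
  nonempty for \<open>k \<ge> 2\<close>.\<close>

definition clique_free_densities :: "nat \<Rightarrow> 'a graph \<Rightarrow> nat \<Rightarrow> real set" where
  "clique_free_densities k F n = {induced_density F G | G :: nat graph.
     simple_graph G \<and> card (verts G) = n \<and> \<not> contains_subgraph G (complete_simple_graph k)}"

definition max_density :: "nat \<Rightarrow> 'a graph \<Rightarrow> nat \<Rightarrow> real" where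
  "max_density k F n = Max (clique_free_densities k F n)"

definition inducibility :: "nat \<Rightarrow> 'a graph \<Rightarrow> real" where
  "inducibility k F = lim (\<lambda>n. max_density k F n)"

text \<open>For positive \<open>x\<^sub>1, \<dots>, x\<^sub>l\<close> summing to \<open>1\<close>, consecutive half-open intervals of these lengths,
  the last one closed, partition \<open>[0,1]\<close>.\<close>

definition part :: "real list \<Rightarrow> nat \<Rightarrow> real set" where
  "part xs i = (if Suc i = length xs then {sum_list (take i xs)..sum_list xs}
     else {sum_list (take i xs)..<sum_list (take (Suc i) xs)})"

definition multipartite_graphon :: "real list \<Rightarrow> real \<Rightarrow> real \<Rightarrow> real" where
  "multipartite_graphon xs x y =
     (if \<exists>i<length xs. \<exists>j<length xs. i \<noteq> j \<and> x \<in> part xs i \<and> y \<in> part xs j then 1 else 0)"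

text \<open>The sampled points are indexed by \<open>{..<n}\<close>, and the graph lives on the indices, so coinciding
  points (an event of probability \<open>0\<close>) cause no difficulty.\<close>

definition sampled_graph :: "(real \<Rightarrow> real \<Rightarrow> real) \<Rightarrow> nat \<Rightarrow> (nat \<Rightarrow> real) \<Rightarrow> nat graph" where
  "sampled_graph W n \<omega> =
     ({..<n}, {{i, j} | i j. i < n \<and> j < n \<and> i \<noteq> j \<and> W (\<omega> i) (\<omega> j) = 1})"

definition uniform_points :: "nat \<Rightarrow> (nat \<Rightarrow> real) measure" where
  "uniform_points n = PiM {..<n} (\<lambda>_. uniform_measure lborel {0..1})"

definition graphon_induced_density :: "'a graph \<Rightarrow> (real \<Rightarrow> real \<Rightarrow> real) \<Rightarrow> real" where
  "graphon_induced_density F W =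
     (let n = card (verts F) in
      measure (uniform_points n)
        {\<omega> \<in> space (uniform_points n). graph_iso F (sampled_graph W n \<omega>)})"

definition inducibility_attained_by :: "nat \<Rightarrow> 'a graph \<Rightarrow> (real \<Rightarrow> real \<Rightarrow> real) \<Rightarrow> bool" where
  "inducibility_attained_by k F W \<longleftrightarrow> graphon_induced_density F W = inducibility k F"

subsection \<open>The limit exists\<close>

lemma finite_clique_free_densities: "finite (clique_free_densities k F n)"
proof (rule finite_subset)
  show "clique_free_densities k F n \<subseteq>
      (\<lambda>m. real m / real (n choose card (verts F))) ` {..2 ^ n}"
  proof
    fix d assume "d \<in> clique_free_densities k F n"
    then obtain G :: "nat graph" where G: "simple_graph G" "card (verts G) = n"
      and d: "d = induced_density F G"
      unfolding clique_free_densities_def by blast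
    have fin: "finite (verts G)" using G by (simp add: simple_graph_def)
    have "induced_count F G \<le> card (Pow (verts G))"
      unfolding induced_count_def using fin by (intro card_mono) auto
    then have "induced_count F G \<le> 2 ^ n" using fin G by (simp add: card_Pow)
    then show "d \<in> (\<lambda>m. real m / real (n choose card (verts F))) ` {..2 ^ n}"
      using G d unfolding induced_density_def by auto
  qed
qed simp

lemma clique_free_densities_nonempty:
  assumes "k \<ge> 2"
  shows "clique_free_densities k F n \<noteq> {}"
proof -
  let ?G = "({..<n}, {}) :: nat graph"
  have "{0, 1} \<in> edges (complete_simple_graph k)" using assms by (auto simp: complete_simple_graph_def)
  then have "\<not> contains_subgraph ?G (complete_simple_graph k)"
    by (auto simp: contains_subgraph_def)
  moreover have "simple_graph ?G" "card (verts ?G) = n" by (simp_all add: simple_graph_def)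
  ultimately show ?thesis unfolding clique_free_densities_def by blast
qed

lemma induced_count_delete:
  assumes fin: "finite (verts G)"
  shows "(\<Sum>v\<in>verts G. induced_count F (induced_subgraph G (verts G - {v})))
           = (card (verts G) - card (verts F)) * induced_count F G"
proof -
  define A where "A = {S. S \<subseteq> verts G \<and> card S = card (verts F) \<and>
     graph_iso F (induced_subgraph G S)}"
  have finA: "finite A" unfolding A_def using fin by simp
  have ind: "induced_subgraph (induced_subgraph G (verts G - {v})) S = induced_subgraph G S"
    if "S \<subseteq> verts G - {v}" for v S
    using that by (auto simp: induced_subgraph_def)
  have "induced_count F (induced_subgraph G (verts G - {v})) = card {S \<in> A. v \<notin> S}" for v
  proof -
    have V: "verts (induced_subgraph G (verts G - {v})) = verts G - {v}"
      by (simp add: induced_subgraph_def)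
    have "{S. S \<subseteq> verts (induced_subgraph G (verts G - {v})) \<and> card S = card (verts F) \<and>
      graph_iso F (induced_subgraph (induced_subgraph G (verts G - {v})) S)} = {S \<in> A. v \<notin> S}"
      unfolding A_def V by (intro Collect_cong) (use ind[of _ v] in \<open>auto simp: subset_Diff_insert\<close>)
    then show ?thesis unfolding induced_count_def by simp
  qed
  then have "(\<Sum>v\<in>verts G. induced_count F (induced_subgraph G (verts G - {v})))
      = (\<Sum>v\<in>verts G. \<Sum>S\<in>A. if v \<notin> S then 1 else 0)"
    using finA by (simp flip: sum.inter_filter)
  also have "\<dots> = (\<Sum>S\<in>A. \<Sum>v\<in>verts G. if v \<notin> S then 1 else 0)"
    by (rule sum.swap)
  also have "\<dots> = (\<Sum>S\<in>A. card (verts G) - card (verts F))"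
  proof (rule sum.cong[OF refl])
    fix S assume "S \<in> A"
    then have S: "S \<subseteq> verts G" "card S = card (verts F)" by (auto simp: A_def)
    have "(\<Sum>v\<in>verts G. if v \<notin> S then 1 else 0) = card (verts G - S)"
      using fin by (simp add: set_diff_eq flip: sum.inter_filter)
    also have "\<dots> = card (verts G) - card (verts F)"
      using S fin by (metis card_Diff_subset finite_subset)
    finally show "(\<Sum>v\<in>verts G. if v \<notin> S then 1 else 0) = card (verts G) - card (verts F)" .
  qed
  finally show ?thesis by (simp add: induced_count_def A_def)
qed

lemma max_density_Suc_le:
  assumes k: "k \<ge> 2" and n: "n \<ge> card (verts F)"
  shows "max_density k F (Suc n) \<le> max_density k F n"
  unfolding max_density_def[of k F "Suc n"]
proof (rule Max.boundedI[OF finite_clique_free_densities clique_free_densities_nonempty[OF k]])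
  fix d assume "d \<in> clique_free_densities k F (Suc n)"
  then obtain G :: "nat graph" where G: "simple_graph G" "card (verts G) = Suc n"
      "\<not> contains_subgraph G (complete_simple_graph k)" and d: "d = induced_density F G"
    unfolding clique_free_densities_def by blast
  define m where "m = card (verts F)"
  define M where "M = max_density k F n"
  have fin: "finite (verts G)" using G by (simp add: simple_graph_def)
  have le: "real (induced_count F (induced_subgraph G (verts G - {v}))) \<le> M * real (n choose m)"
    if v: "v \<in> verts G" for v
  proof -
    let ?H = "induced_subgraph G (verts G - {v})"
    have V: "verts ?H = verts G - {v}" by (simp add: induced_subgraph_def)
    have "simple_graph ?H" using G by (auto simp: simple_graph_def induced_subgraph_def)
    moreover have cH: "card (verts ?H) = n" using V v G fin by simp
    moreover have "\<not> contains_subgraph ?H (complete_simple_graph k)"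
    proof
      assume "contains_subgraph ?H (complete_simple_graph k)"
      then have "contains_subgraph G (complete_simple_graph k)"
        unfolding contains_subgraph_def induced_subgraph_def by (auto; blast)
      with G show False by simp
    qed
    ultimately have "induced_density F ?H \<in> clique_free_densities k F n"
      unfolding clique_free_densities_def by blast
    then have "induced_density F ?H \<le> M"
      unfolding M_def max_density_def by (rule Max_ge[OF finite_clique_free_densities])
    moreover have "n choose m > 0" using n by (simp add: m_def zero_less_binomial)
    ultimately show ?thesis
      unfolding induced_density_def cH m_def[symmetric] by (simp add: field_simps)
  qed
  have "real (Suc n - m) * real (induced_count F G)
      = (\<Sum>v\<in>verts G. real (induced_count F (induced_subgraph G (verts G - {v}))))"
    using induced_count_delete[OF fin, of F] G by (simp add: m_def flip: of_nat_sum of_nat_mult)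
  also have "\<dots> \<le> (\<Sum>v\<in>verts G. M * real (n choose m))" by (rule sum_mono) (rule le)
  also have "\<dots> = M * real (Suc n * (n choose m))" using G
    by (simp only: sum_constant of_nat_mult mult_ac)
  also have "Suc n * (n choose m) = (Suc n - m) * (Suc n choose m)"
    using binomial_absorb_comp[of "Suc n" m] by simp
  finally have "real (Suc n - m) * real (induced_count F G)
      \<le> real (Suc n - m) * (M * real (Suc n choose m))" by (simp add: mult_ac)
  then have "real (induced_count F G) \<le> M * real (Suc n choose m)"
    using n by (simp add: m_def)
  moreover have "Suc n choose m > 0" using n by (simp add: m_def zero_less_binomial)
  ultimately show "d \<le> max_density k F n"
    unfolding d induced_density_def G(2) m_def[symmetric] M_def[symmetric]
    by (simp add: field_simps)
qed

lemma max_density_nonneg: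
  assumes "k \<ge> 2"
  shows "max_density k F n \<ge> 0"
proof -
  have "max_density k F n \<in> clique_free_densities k F n"
    unfolding max_density_def
    by (rule Max_in[OF finite_clique_free_densities clique_free_densities_nonempty[OF assms]])
  then show ?thesis by (auto simp: clique_free_densities_def induced_density_def)
qed

lemma convergent_max_density:
  assumes "k \<ge> 2"
  shows "convergent (\<lambda>n. max_density k F n)"
proof -
  let ?m = "card (verts F)"
  have "decseq (\<lambda>n. max_density k F (n + ?m))"
    by (rule decseq_SucI) (use max_density_Suc_le[OF assms, of F] in simp)
  then obtain L where "(\<lambda>n. max_density k F (n + ?m)) \<longlonglongrightarrow> L"
    by (rule decseq_convergent[where B = 0]) (auto intro: max_density_nonneg[OF assms])
  then have "(\<lambda>n. max_density k F n) \<longlonglongrightarrow> L" by (rule LIMSEQ_offset)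
  then show ?thesis by (rule convergentI)
qed

end

theory Submission
  imports Defs
begin

text \<open>
  A graph of the form \<open>K\<^sub>r\<^sup>-\<close> is a clique \<open>K\<close> on \<open>r - 2\<close> vertices together with two non-adjacent common
  neighbours of \<open>K\<close>.  So its density in a blow-up of a graph \<open>G\<close>, whose classes are independent sets
  with weights \<open>w\<close> of sum \<open>1\<close>, is a constant times the polynomial
  \<open>L(w) = \<Sum>\<^sub>K w(K) \<Sum> w(u) w(v)\<close>, where \<open>K\<close> ranges over the \<open>(r - 2)\<close>-cliques of \<open>G\<close> and \<open>(u, v)\<close> over
  the ordered non-adjacent pairs of common neighbours, the pairs \<open>(u, u)\<close> included.  With uniform
  weights on \<open>n\<close> vertices, \<open>n\<^sup>r L / 2\<close> bounds the number of induced copies of \<open>K\<^sub>r\<^sup>-\<close> in \<open>G\<close> itself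
  (\<open>induced_count_le_lagrangian\<close>).

  The maximum of \<open>L\<close> over the simplex of weights is found as in the proof of Motzkin and Straus.  Choose
  a maximiser \<open>w\<close> with as few non-zero weights as possible.

  \<^item> Moving weight between two non-adjacent vertices changes \<open>L\<close> by a convex quadratic, because the
    quadratic coefficient is a sum of terms \<open>w(K) (\<Sum>\<^sub>v \<delta>(v))\<^sup>2\<close>, where \<open>\<delta>\<close> is \<open>1\<close> and \<open>-1\<close> at the two
    vertices and \<open>v\<close> runs over those of them that are common neighbours of \<open>K\<close>
    (\<open>lagrangian_term_move_weight\<close>).  One of the two weights could therefore be made \<open>0\<close> without loss,
    so the support of \<open>w\<close> is a clique.

  \<^item> On a clique, \<open>L = e\<^bsub>r-1\<^esub> - r e\<^sub>r\<close> with elementary symmetric polynomials \<open>e\<^sub>j\<close> (\<open>lagrangian_on_clique\<close>),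
    and this has the form \<open>A + B xy\<close> in any two of the weights \<open>x\<close>, \<open>y\<close> when their sum is kept.  If
    \<open>B \<le> 0\<close>, one of the two could be emptied; if \<open>B > 0\<close>, making them equal is strictly better.  So all
    non-zero weights are equal.

  Hence, for a \<open>K\<^sub>k\<close>-free \<open>G\<close>, the maximum is the value of \<open>L\<close> on some balanced clique with \<open>l < k\<close> vertices,
  which is \<open>(r - 1) (l choose (r - 1)) / l\<^sup>r\<close> (\<open>lagrangian_le_balanced\<close>).  The passage from \<open>l\<close> to
  \<open>l + 1\<close> increases this value or not according to the sign of
  \<open>(1 - 1/n)\<^sup>r - (1 - (r - 1)/n)\<close> with \<open>n = l + 1\<close>, and truncated binomial expansions of \<open>(1 - 1/n)\<^sup>r\<close>
  locate the change of sign precisely enough to see that the best \<open>l\<close> is \<open>min (k - 1) t\<close>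
  (\<open>balanced_value_le_optimum\<close>).

  Conversely, let \<open>D\<close> be the proportion of colourings of \<open>r\<close> points with \<open>l\<close> colours in which exactly one
  pair of points has the same colour.  It is the density of \<open>K\<^sub>r\<^sup>-\<close> in the balanced \<open>l\<close>-partite graphon
  (\<open>graphon_density_balanced\<close>), and it is also the average density of \<open>K\<^sub>r\<^sup>-\<close> in the complete multipartite
  graphs given by all the \<open>l\<close>-colourings of \<open>n\<close> points; these contain no \<open>K\<^sub>k\<close>, so some such graph on
  \<open>n\<close> vertices has density at least \<open>D\<close>.  Counting the colourings shows that \<open>D\<close> agrees with the upper
  bound, and both bounds together give the limit.
\<close>

section \<open>The Lagrangian of a graph\<close>

definition clique :: "'a graph \<Rightarrow> 'a set \<Rightarrow> bool" where
  "clique G K \<longleftrightarrow> K \<subseteq> verts G \<and> (\<forall>x\<in>K. \<forall>y\<in>K. x \<noteq> y \<longrightarrow> {x, y} \<in> edges G)"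

definition cliques :: "'a graph \<Rightarrow> nat \<Rightarrow> 'a set set" where
  "cliques G j = {K. clique G K \<and> card K = j}"

definition common_nbrs :: "'a graph \<Rightarrow> 'a set \<Rightarrow> 'a set" where
  "common_nbrs G K = {v \<in> verts G. \<forall>x\<in>K. {x, v} \<in> edges G}"

text \<open>
  The diagonal pairs \<open>(u, u)\<close> belong to this set; in a blow-up they stand for two
  vertices of the same class.
\<close>
definition open_pairs :: "'a graph \<Rightarrow> 'a set \<Rightarrow> ('a \<times> 'a) set" where
  "open_pairs G K =
     {p \<in> common_nbrs G K \<times> common_nbrs G K. {fst p, snd p} \<notin> edges G}"

text \<open>
  Multiplied by \<open>(a + 2)! / 2\<close>, this is the density of induced copies of
  \<open>K\<^bsub>a+2\<^esub>\<^sup>-\<close> in the blow-up of \<open>G\<close> with class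
  weights \<open>w\<close>: the set \<open>K\<close> holds the vertices of full degree, and the
  pair is the missing edge in either order.
\<close>
definition lagrangian :: "nat \<Rightarrow> 'a graph \<Rightarrow> ('a \<Rightarrow> real) \<Rightarrow> real" where
  "lagrangian a G w =
     (\<Sum>K\<in>cliques G a. (\<Prod>x\<in>K. w x) * (\<Sum>p\<in>open_pairs G K. w (fst p) * w (snd p)))"

text \<open>
  Weights vanish outside \<open>V\<close>, so that this is a compact set of functions in the
  product topology.
\<close>
definition weightings :: "'a set \<Rightarrow> ('a \<Rightarrow> real) set" where
  "weightings V = {w. (\<forall>v. 0 \<le> w v) \<and> (\<forall>v. v \<notin> V \<longrightarrow> w v = 0) \<and> sum w V = 1}"

definition move_weight :: "'a \<Rightarrow> 'a \<Rightarrow> real \<Rightarrow> ('a \<Rightarrow> real) \<Rightarrow> 'a \<Rightarrow> real" where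
  "move_weight x y d w v = w v + d * (of_bool (v = x) - of_bool (v = y))"

definition weight_support :: "'a set \<Rightarrow> ('a \<Rightarrow> real) \<Rightarrow> 'a set" where
  "weight_support V w = {v \<in> V. w v \<noteq> 0}"

lemma simple_graph_finite: "simple_graph G \<Longrightarrow> finite (verts G)"
  by (simp add: simple_graph_def)

lemma simple_graph_no_loop: "simple_graph G \<Longrightarrow> {x} \<notin> edges G"
  by (auto simp: simple_graph_def)

lemma finite_cliques: "simple_graph G \<Longrightarrow> finite (cliques G j)"
  unfolding cliques_def clique_def
  by (rule finite_subset[of _ "Pow (verts G)"]) (auto simp: simple_graph_finite)

lemma finite_clique: "simple_graph G \<Longrightarrow> K \<in> cliques G j \<Longrightarrow> finite K"
  unfolding cliques_def clique_def by (auto intro: finite_subset simple_graph_finite)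

lemma finite_open_pairs: "simple_graph G \<Longrightarrow> finite (open_pairs G K)"
  unfolding open_pairs_def common_nbrs_def
  by (rule finite_subset[of _ "verts G \<times> verts G"]) (auto simp: simple_graph_finite)

lemma common_nbrs_disjoint: "simple_graph G \<Longrightarrow> v \<in> common_nbrs G K \<Longrightarrow> v \<notin> K"
  using simple_graph_no_loop[of G v] by (auto simp: common_nbrs_def)

section \<open>Moving weight between two vertices\<close>

lemma move_weight_simps:
  assumes "x \<noteq> y"
  shows "move_weight x y d w x = w x + d" "move_weight x y d w y = w y - d"
    "v \<noteq> x \<Longrightarrow> v \<noteq> y \<Longrightarrow> move_weight x y d w v = w v"
  using assms by (auto simp: move_weight_def)

lemma move_weight_weighting:
  assumes w: "w \<in> weightings V" and V: "finite V" "x \<in> V" "y \<in> V" "x \<noteq> y"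
    and d: "- w x \<le> d" "d \<le> w y"
  shows "move_weight x y d w \<in> weightings V"
proof -
  have "sum (move_weight x y d w) V = sum w V + d * ((\<Sum>v\<in>V. of_bool (v = x)) - (\<Sum>v\<in>V. of_bool (v = y)))"
    unfolding move_weight_def sum.distrib sum_subtractf[symmetric] sum_distrib_left ..
  also have "\<dots> = sum w V"
    using V by (simp add: of_bool_def sum.delta')
  finally have "sum (move_weight x y d w) V = 1" using w by (simp add: weightings_def)
  then show ?thesis using w V d by (auto simp: weightings_def move_weight_def)
qed

lemma support_move_weight:
  assumes V: "finite V" "x \<in> weight_support V w" "y \<in> weight_support V w" "x \<noteq> y"
    and d: "d = w y \<or> d = - w x"
  shows "card (weight_support V (move_weight x y d w)) < card (weight_support V w)"
proof (rule psubset_card_mono)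
  show "finite (weight_support V w)" using V by (simp add: weight_support_def)
  show "weight_support V (move_weight x y d w) \<subset> weight_support V w"
    using V d by (auto simp: weight_support_def move_weight_def split: if_splits)
qed

text \<open>
  If the clique \<open>K\<close> contains \<open>x\<close> or \<open>y\<close>, it contains just
  one of them, and neither is a common neighbour of \<open>K\<close>, so the term is linear in
  \<open>d\<close>.  Otherwise only the sum over pairs changes, and its quadratic coefficient is a
  square.
\<close>
lemma lagrangian_term_move_weight:
  assumes G: "simple_graph G" and w: "\<And>v. 0 \<le> w v"
    and xy: "x \<noteq> y" "{x, y} \<notin> edges G" and K: "K \<in> cliques G a"
  shows "\<exists>b c. 0 \<le> c \<and> (\<forall>d. (\<Prod>v\<in>K. move_weight x y d w v) *
        (\<Sum>p\<in>open_pairs G K. move_weight x y d w (fst p) * move_weight x y d w (snd p))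
      = (\<Prod>v\<in>K. w v) * (\<Sum>p\<in>open_pairs G K. w (fst p) * w (snd p)) + b * d + c * d^2)"
proof -
  let ?N = "common_nbrs G K" and ?P = "open_pairs G K"
  have fK: "finite K" using finite_clique[OF G K] .
  \<comment> \<open>The point \<open>x\<close> or \<open>y\<close> outside \<open>K\<close> is not adjacent to the one inside.\<close>
  have inner: "(\<Sum>p\<in>?P. move_weight x y d w (fst p) * move_weight x y d w (snd p))
      = (\<Sum>p\<in>?P. w (fst p) * w (snd p))" if "x \<in> K \<or> y \<in> K" for d
  proof (rule sum.cong[OF refl])
    fix p assume p: "p \<in> ?P"
    have "{y, x} \<notin> edges G" using xy(2) by (simp add: insert_commute)
    then have "x \<notin> ?N \<and> y \<notin> ?N"
      using that xy(2) common_nbrs_disjoint[OF G] unfolding common_nbrs_def by blast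
    then have "fst p \<noteq> x" "fst p \<noteq> y" "snd p \<noteq> x" "snd p \<noteq> y"
      using p by (auto simp: open_pairs_def)
    then show "move_weight x y d w (fst p) * move_weight x y d w (snd p) = w (fst p) * w (snd p)"
      by (simp add: move_weight_def)
  qed
  have notboth: "\<not> (x \<in> K \<and> y \<in> K)" using K xy by (auto simp: cliques_def clique_def)
  have prod_in: "(\<Prod>v\<in>K. move_weight x y d w v) = (\<Prod>v\<in>K. w v) + s * d * (\<Prod>v\<in>K-{z}. w v)"
    if z: "z \<in> K" "s = of_bool (z = x) - of_bool (z = y)" "K \<inter> {x, y} = {z}" for d z s
  proof -
    have "(\<Prod>v\<in>K. move_weight x y d w v) = move_weight x y d w z * (\<Prod>v\<in>K-{z}. move_weight x y d w v)"
      by (rule prod.remove[OF fK z(1)])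
    also have "(\<Prod>v\<in>K-{z}. move_weight x y d w v) = (\<Prod>v\<in>K-{z}. w v)"
      using z by (intro prod.cong) (auto simp: move_weight_def)
    also have "move_weight x y d w z = w z + s * d" unfolding move_weight_def z(2) by simp
    finally show ?thesis using prod.remove[OF fK z(1), of w] by (simp add: distrib_right)
  qed
  consider z where "z \<in> K" "K \<inter> {x, y} = {z}" | "x \<notin> K" "y \<notin> K"
    using notboth by blast
  then show ?thesis
  proof cases
    case (1 z)
    define s :: real where "s = of_bool (z = x) - of_bool (z = y)"
    have "z \<in> {x, y}" using 1(2) by (metis IntE insertI1)
    then have "x \<in> K \<or> y \<in> K" using 1(1) by auto
    then have "(\<Prod>v\<in>K. move_weight x y d w v) *
        (\<Sum>p\<in>?P. move_weight x y d w (fst p) * move_weight x y d w (snd p))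
      = (\<Prod>v\<in>K. w v) * (\<Sum>p\<in>?P. w (fst p) * w (snd p))
        + (s * (\<Prod>v\<in>K-{z}. w v) * (\<Sum>p\<in>?P. w (fst p) * w (snd p))) * d + 0 * d^2" for d
      by (simp only: inner prod_in[OF 1(1) s_def 1(2)]) (simp add: distrib_right)
    then show ?thesis by blast
  next
    case 2
    define \<delta> :: "'a \<Rightarrow> real" where "\<delta> v = of_bool (v = x) - of_bool (v = y)" for v
    define b where "b = (\<Sum>p\<in>?P. \<delta> (fst p) * w (snd p) + w (fst p) * \<delta> (snd p))"
    define c where "c = (\<Sum>p\<in>?P. \<delta> (fst p) * \<delta> (snd p))"
    have prod_out: "(\<Prod>v\<in>K. move_weight x y d w v) = (\<Prod>v\<in>K. w v)" for d
      using 2 by (intro prod.cong) (auto simp: move_weight_def)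
    have quad: "(\<Sum>p\<in>?P. move_weight x y d w (fst p) * move_weight x y d w (snd p))
        = (\<Sum>p\<in>?P. w (fst p) * w (snd p)) + b * d + c * d^2" for d
      unfolding b_def c_def move_weight_def \<delta>_def[symmetric] sum_distrib_right sum.distrib[symmetric]
      by (intro sum.cong) (auto simp: algebra_simps power2_eq_square)
    \<comment> \<open>Only pairs inside \<open>{x, y}\<close> count, and since \<open>x\<close>, \<open>y\<close> are not adjacent, they all count
      as soon as both points are common neighbours; the terms are then \<open>1, 1, -1, -1\<close>.\<close>
    have "c = (\<Sum>p\<in>({x, y} \<inter> ?N) \<times> ({x, y} \<inter> ?N). \<delta> (fst p) * \<delta> (snd p))"
      unfolding c_def
    proof (rule sum.mono_neutral_right)
      show "({x, y} \<inter> ?N) \<times> ({x, y} \<inter> ?N) \<subseteq> ?P"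
        using xy(2) xy(2)[unfolded insert_commute[of x]] simple_graph_no_loop[OF G]
        by (auto simp: open_pairs_def)
    qed (rule finite_open_pairs[OF G], auto simp: open_pairs_def \<delta>_def)
    also have "\<dots> = (\<Sum>v\<in>{x, y} \<inter> ?N. \<delta> v)^2"
      by (simp add: power2_eq_square sum_product sum.cartesian_product split_def)
    finally have "0 \<le> c" by simp
    then show ?thesis
      unfolding prod_out quad
      by (intro exI[of _ "(\<Prod>v\<in>K. w v) * b"] exI[of _ "(\<Prod>v\<in>K. w v) * c"] conjI allI)
         (simp_all add: distrib_left prod_nonneg w)
  qed
qed

lemma lagrangian_move_weight_convex:
  assumes G: "simple_graph G" and w: "\<And>v. 0 \<le> w v"
    and xy: "x \<noteq> y" "{x, y} \<notin> edges G"
  obtains b c where "0 \<le> c" "\<And>d. lagrangian a G (move_weight x y d w) = lagrangian a G w + b * d + c * d^2"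
proof -
  have "\<forall>K\<in>cliques G a. \<exists>b c. 0 \<le> c \<and> (\<forall>d. (\<Prod>v\<in>K. move_weight x y d w v) *
        (\<Sum>p\<in>open_pairs G K. move_weight x y d w (fst p) * move_weight x y d w (snd p))
      = (\<Prod>v\<in>K. w v) * (\<Sum>p\<in>open_pairs G K. w (fst p) * w (snd p)) + b * d + c * d^2)"
    using lagrangian_term_move_weight[of G w x y, OF G w xy] by blast
  from bchoice[OF this] obtain b where "\<forall>K\<in>cliques G a. \<exists>c. 0 \<le> c \<and> (\<forall>d. (\<Prod>v\<in>K. move_weight x y d w v) *
        (\<Sum>p\<in>open_pairs G K. move_weight x y d w (fst p) * move_weight x y d w (snd p))
      = (\<Prod>v\<in>K. w v) * (\<Sum>p\<in>open_pairs G K. w (fst p) * w (snd p)) + b K * d + c * d^2)" ..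
  from bchoice[OF this] obtain c where bc: "\<forall>K\<in>cliques G a. 0 \<le> c K \<and> (\<forall>d. (\<Prod>v\<in>K. move_weight x y d w v) *
        (\<Sum>p\<in>open_pairs G K. move_weight x y d w (fst p) * move_weight x y d w (snd p))
      = (\<Prod>v\<in>K. w v) * (\<Sum>p\<in>open_pairs G K. w (fst p) * w (snd p)) + b K * d + c K * d^2)" ..
  show ?thesis
  proof (rule that)
    show "0 \<le> (\<Sum>K\<in>cliques G a. c K)" using bc by (intro sum_nonneg) blast
    show "lagrangian a G (move_weight x y d w)
        = lagrangian a G w + (\<Sum>K\<in>cliques G a. b K) * d + (\<Sum>K\<in>cliques G a. c K) * d^2" for d
      unfolding lagrangian_def sum_distrib_right sum.distrib[symmetric]
      using bc by (intro sum.cong) auto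
  qed
qed

lemma compact_weightings:
  assumes "finite V"
  shows "compact (weightings V)"
proof -
  define B :: "'a \<Rightarrow> real set" where "B v = (if v \<in> V then {0..1} else {0})" for v
  have "compactin (product_topology (\<lambda>_. euclidean) UNIV) (PiE UNIV B)"
    by (auto simp: compactin_PiE B_def)
  then have cB: "compact (PiE UNIV B)"
    by (simp add: euclidean_product_topology)
  have "closed {w :: 'a \<Rightarrow> real. sum w V = 1}"
    by (intro closed_Collect_eq continuous_on_sum continuous_on_product_coordinates continuous_on_const)
  then have c: "compact (PiE UNIV B \<inter> {w. sum w V = 1})"
    by (rule compact_Int_closed[OF cB])
  have "weightings V = PiE UNIV B \<inter> {w. sum w V = 1}"
  proof (intro equalityI subsetI)
    fix w assume w: "w \<in> weightings V"
    have "w v \<le> 1" if "v \<in> V" for v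
      using w member_le_sum[OF that, of w] assms by (auto simp: weightings_def)
    then show "w \<in> PiE UNIV B \<inter> {w. sum w V = 1}"
      using w by (auto simp: weightings_def B_def)
  next
    fix w assume "w \<in> PiE UNIV B \<inter> {w. sum w V = 1}"
    then have *: "\<And>v. w v \<in> B v" "sum w V = 1" by auto
    show "w \<in> weightings V"
      unfolding weightings_def using *(1) *(2) by (auto simp: B_def split: if_splits) (metis atLeastAtMost_iff order_refl singletonD)+
  qed
  with c show ?thesis by simp
qed

lemma continuous_lagrangian: "continuous_on S (lagrangian a G)"
  unfolding lagrangian_def
  by (intro continuous_intros continuous_on_subset[OF continuous_on_product_coordinates]) auto

text \<open>
  Minimal support is what forces the structure of the maximiser: no move of weight that keeps the
  Lagrangian at its maximum can set a further weight to \<open>0\<close>.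
\<close>
lemma minimal_maximizer:
  assumes G: "simple_graph G" and V: "verts G \<noteq> {}"
  obtains w where "w \<in> weightings (verts G)"
    "\<And>u. u \<in> weightings (verts G) \<Longrightarrow> lagrangian a G u \<le> lagrangian a G w"
    "\<And>u. u \<in> weightings (verts G) \<Longrightarrow> lagrangian a G w \<le> lagrangian a G u \<Longrightarrow>
       card (weight_support (verts G) w) \<le> card (weight_support (verts G) u)"
proof -
  let ?W = "weightings (verts G)" and ?L = "lagrangian a G"
  obtain v where "v \<in> verts G" using V by blast
  then have "(\<lambda>u. of_bool (u = v)) \<in> ?W"
    using simple_graph_finite[OF G] by (auto simp: weightings_def of_bool_def)
  then obtain u where u: "u \<in> ?W" "\<forall>y\<in>?W. ?L y \<le> ?L u"
    using continuous_attains_sup[OF compact_weightings[OF simple_graph_finite[OF G]] _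
      continuous_lagrangian] by blast
  then obtain w where w: "w \<in> ?W \<and> (\<forall>y\<in>?W. ?L y \<le> ?L w)"
    "\<And>y. y \<in> ?W \<and> (\<forall>z\<in>?W. ?L z \<le> ?L y) \<Longrightarrow>
       card (weight_support (verts G) w) \<le> card (weight_support (verts G) y)"
    using ex_has_least_nat[of "\<lambda>w. w \<in> ?W \<and> (\<forall>y\<in>?W. ?L y \<le> ?L w)" u
        "\<lambda>w. card (weight_support (verts G) w)"] by blast
  show ?thesis
  proof (rule that[of w])
    fix y assume "y \<in> ?W" "?L w \<le> ?L y"
    then show "card (weight_support (verts G) w) \<le> card (weight_support (verts G) y)"
      using w by (meson order_trans)
  qed (use w in auto)
qed

section \<open>Elementary symmetric polynomials\<close>

text \<open>
  Double counting: choosing a set and then a new point amounts to choosing the enlarged set and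
  then one of its points.
\<close>
lemma sum_subset_reindex:
  fixes \<phi> :: "'a set \<Rightarrow> 'a \<Rightarrow> real"
  assumes S: "finite S"
  shows "(\<Sum>K\<in>{K. K \<subseteq> S \<and> card K = j}. \<Sum>u\<in>S - K. \<phi> (insert u K) u)
       = (\<Sum>J\<in>{J. J \<subseteq> S \<and> card J = Suc j}. \<Sum>u\<in>J. \<phi> J u)"
proof -
  have fin: "finite {K. K \<subseteq> S \<and> card K = i}" for i using S by simp
  have fK: "finite K" if "K \<subseteq> S" for K using that S by (rule finite_subset)
  show ?thesis
    unfolding sum.Sigma[OF fin ballI[OF finite_Diff[OF S]]]
    apply (subst sum.Sigma)
    subgoal by (rule fin)
    subgoal using fK by auto
    apply (rule sum.reindex_bij_witness[where j = "\<lambda>(K, u). (insert u K, u)" and i = "\<lambda>(J, u). (J - {u}, u)"])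
    using fK by (auto simp: insert_absorb)
qed

text \<open>
  The elementary symmetric polynomial \<open>e\<^sub>j\<close> in the variables \<open>w
  x\<close>, \<open>x \<in> S\<close>.
\<close>
definition esym :: "'a set \<Rightarrow> nat \<Rightarrow> ('a \<Rightarrow> real) \<Rightarrow> real" where
  "esym S j w = (\<Sum>K\<in>{K. K \<subseteq> S \<and> card K = j}. \<Prod>x\<in>K. w x)"

lemma esym_cong: "(\<And>x. x \<in> S \<Longrightarrow> w x = w' x) \<Longrightarrow> esym S j w = esym S j w'"
  unfolding esym_def by (intro sum.cong prod.cong) auto

lemma esym_insert:
  assumes S: "finite S" and x: "x \<notin> S"
  shows "esym (insert x S) (Suc j) w = esym S (Suc j) w + w x * esym S j w"
proof -
  let ?A = "{K. K \<subseteq> S \<and> card K = Suc j}" and ?B = "{K. K \<subseteq> S \<and> card K = j}"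
  have fK: "finite K" if "K \<subseteq> S" for K using that S by (rule finite_subset)
  have split: "{K. K \<subseteq> insert x S \<and> card K = Suc j} = ?A \<union> insert x ` ?B"
  proof (intro equalityI subsetI)
    fix K assume K: "K \<in> {K. K \<subseteq> insert x S \<and> card K = Suc j}"
    show "K \<in> ?A \<union> insert x ` ?B"
    proof (cases "x \<in> K")
      case True
      then have "K = insert x (K - {x})" "K - {x} \<subseteq> S" "card (K - {x}) = j" using K by auto
      then show ?thesis by blast
    qed (use K in auto)
  next
    fix K assume "K \<in> ?A \<union> insert x ` ?B"
    then show "K \<in> {K. K \<subseteq> insert x S \<and> card K = Suc j}"
      using fK x by (auto simp: card_insert_if)
  qed
  have "esym (insert x S) (Suc j) w = (\<Sum>K\<in>?A. \<Prod>x\<in>K. w x) + (\<Sum>K\<in>insert x ` ?B. \<Prod>x\<in>K. w x)"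
    unfolding esym_def split by (rule sum.union_disjoint) (use S x in auto)
  also have "(\<Sum>K\<in>insert x ` ?B. \<Prod>x\<in>K. w x) = (\<Sum>K\<in>?B. \<Prod>x\<in>insert x K. w x)"
    using x by (subst sum.reindex) (auto intro!: inj_onI simp: insert_ident subset_iff)
  also have "\<dots> = w x * esym S j w"
    unfolding esym_def sum_distrib_left using x fK by (intro sum.cong refl prod.insert) auto
  finally show ?thesis by (simp add: esym_def)
qed

lemma esym_two_points:
  assumes S: "finite S" and xy: "x \<in> S" "y \<in> S" "x \<noteq> y"
  shows "esym S (Suc (Suc j)) w = esym (S - {x, y}) (Suc (Suc j)) w
    + (w x + w y) * esym (S - {x, y}) (Suc j) w + w x * w y * esym (S - {x, y}) j w"
proof -
  let ?T = "S - {x, y}"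
  have "S = insert x (insert y ?T)" using xy by auto
  moreover have "finite ?T" "x \<notin> insert y ?T" "y \<notin> ?T" using S xy by auto
  ultimately show ?thesis
    using esym_insert[of "insert y ?T" x "Suc j" w] esym_insert[of ?T y "Suc j" w]
      esym_insert[of ?T y j w] by (simp add: algebra_simps)
qed

lemma esym_const:
  assumes "finite S"
  shows "esym S j (\<lambda>_. q) = real (card S choose j) * q ^ j"
proof -
  have "esym S j (\<lambda>_. q) = (\<Sum>K\<in>{K. K \<subseteq> S \<and> card K = j}. q ^ j)"
    unfolding esym_def by (intro sum.cong) auto
  then show ?thesis by (simp add: n_subsets[OF assms])
qed

text \<open>
  Homogeneously, this is \<open>e\<^sub>1 e\<^bsub>a+1\<^esub> - (a + 2)
  e\<^bsub>a+2\<^esub>\<close>: the product \<open>e\<^sub>1 e\<^bsub>a+1\<^esub>\<close> yields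
  the monomials with one square and, \<open>a + 2\<close> times each, the square-free ones.
\<close>
lemma sum_squares_esym:
  assumes S: "finite S" and w: "sum w S = 1"
  shows "(\<Sum>K\<in>{K. K \<subseteq> S \<and> card K = a}. (\<Prod>x\<in>K. w x) * (\<Sum>u\<in>S - K. w u ^ 2))
       = esym S (a + 1) w - (real a + 2) * esym S (a + 2) w"
proof -
  have fK: "finite K" if "K \<subseteq> S" for K using that S by (rule finite_subset)
  have "(\<Sum>K\<in>{K. K \<subseteq> S \<and> card K = a}. (\<Prod>x\<in>K. w x) * (\<Sum>u\<in>S - K. w u ^ 2))
      = (\<Sum>K\<in>{K. K \<subseteq> S \<and> card K = a}. \<Sum>u\<in>S - K. (\<Prod>x\<in>insert u K. w x) * w u)"
    unfolding sum_distrib_left using fK by (intro sum.cong refl) (auto simp: power2_eq_square)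
  also have "\<dots> = (\<Sum>J\<in>{J. J \<subseteq> S \<and> card J = Suc a}. \<Sum>u\<in>J. (\<Prod>x\<in>J. w x) * w u)"
    by (rule sum_subset_reindex[OF S])
  also have "\<dots> = (\<Sum>J\<in>{J. J \<subseteq> S \<and> card J = Suc a}. (\<Prod>x\<in>J. w x) - (\<Sum>u\<in>S - J. \<Prod>x\<in>insert u J. w x))"
  proof (rule sum.cong[OF refl])
    fix J assume J: "J \<in> {J. J \<subseteq> S \<and> card J = Suc a}"
    then have "sum w J = 1 - sum w (S - J)" using sum_diff[OF S, of J w] w by simp
    moreover have "(\<Sum>u\<in>S - J. \<Prod>x\<in>insert u J. w x) = sum w (S - J) * (\<Prod>x\<in>J. w x)"
      unfolding sum_distrib_right using J fK by (intro sum.cong refl prod.insert) auto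
    moreover have "(\<Sum>u\<in>J. (\<Prod>x\<in>J. w x) * w u) = (\<Prod>x\<in>J. w x) * sum w J"
      by (simp add: sum_distrib_left)
    ultimately show "(\<Sum>u\<in>J. (\<Prod>x\<in>J. w x) * w u)
        = (\<Prod>x\<in>J. w x) - (\<Sum>u\<in>S - J. \<Prod>x\<in>insert u J. w x)"
      by (simp only:) (simp only: right_diff_distrib mult_1_right mult.commute)
  qed
  also have "\<dots> = esym S (a + 1) w
      - (\<Sum>J\<in>{J. J \<subseteq> S \<and> card J = Suc a}. \<Sum>u\<in>S - J. \<Prod>x\<in>insert u J. w x)"
    by (simp add: sum_subtractf esym_def)
  also have "(\<Sum>J\<in>{J. J \<subseteq> S \<and> card J = Suc a}. \<Sum>u\<in>S - J. \<Prod>x\<in>insert u J. w x)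
      = (\<Sum>J\<in>{J. J \<subseteq> S \<and> card J = Suc (Suc a)}. \<Sum>u\<in>J. \<Prod>x\<in>J. w x)"
    by (rule sum_subset_reindex[OF S])
  also have "\<dots> = (real a + 2) * esym S (a + 2) w"
    unfolding esym_def sum_distrib_left by (intro sum.cong) auto
  finally show ?thesis .
qed

section \<open>Optimal weights are balanced on a clique\<close>

text \<open>
  Inside a clique the only non-adjacent pairs are the diagonal ones, which leaves a sum over
  squares.
\<close>
lemma lagrangian_on_clique:
  assumes G: "simple_graph G" and S: "clique G S" and w: "\<And>v. v \<notin> S \<Longrightarrow> w v = 0" "sum w S = 1"
  shows "lagrangian a G w = esym S (a + 1) w - (real a + 2) * esym S (a + 2) w"
proof -
  let ?C = "{K. K \<subseteq> S \<and> card K = a}"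
  have SV: "S \<subseteq> verts G" and fS: "finite S"
    using S simple_graph_finite[OF G] by (auto simp: clique_def intro: finite_subset)
  have sub: "?C \<subseteq> cliques G a" using S by (auto simp: cliques_def clique_def)
  have vanish: "(\<Prod>x\<in>K. w x) = 0" if "K \<in> cliques G a - ?C" for K
  proof -
    have "\<exists>x\<in>K. w x = 0" using that w(1) by (auto simp: cliques_def)
    then show ?thesis using that finite_clique[OF G] by (intro prod_zero) auto
  qed
  have inner: "(\<Sum>p\<in>open_pairs G K. w (fst p) * w (snd p)) = (\<Sum>u\<in>S - K. w u ^ 2)" if "K \<in> ?C" for K
  proof -
    have "(\<Sum>p\<in>open_pairs G K. w (fst p) * w (snd p)) = (\<Sum>p\<in>(\<lambda>u. (u, u)) ` (S - K). w (fst p) * w (snd p))"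
    proof (rule sum.mono_neutral_right)
      show "(\<lambda>u. (u, u)) ` (S - K) \<subseteq> open_pairs G K"
      proof
        fix p assume "p \<in> (\<lambda>u. (u, u)) ` (S - K)"
        then obtain u where u: "p = (u, u)" "u \<in> S" "u \<notin> K" by auto
        have "u \<in> common_nbrs G K"
          using S u that by (auto simp: common_nbrs_def clique_def)
        then show "p \<in> open_pairs G K"
          using u simple_graph_no_loop[OF G] by (auto simp: open_pairs_def)
      qed
      show "\<forall>p\<in>open_pairs G K - (\<lambda>u. (u, u)) ` (S - K). w (fst p) * w (snd p) = 0"
      proof
        fix p assume p: "p \<in> open_pairs G K - (\<lambda>u. (u, u)) ` (S - K)"
        obtain u v where uv: "p = (u, v)" by (cases p)
        have *: "u \<in> common_nbrs G K" "v \<in> common_nbrs G K" "{u, v} \<notin> edges G"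
          using p uv by (auto simp: open_pairs_def)
        have "u \<notin> S \<or> v \<notin> S"
        proof (rule ccontr)
          assume "\<not> (u \<notin> S \<or> v \<notin> S)"
          then have "u = v" "u \<in> S" using S *(3) by (auto simp: clique_def)
          then show False using p uv common_nbrs_disjoint[OF G *(1)] by auto
        qed
        then show "w (fst p) * w (snd p) = 0" using w(1) uv by auto
      qed
    qed (rule finite_open_pairs[OF G])
    also have "\<dots> = (\<Sum>u\<in>S - K. w u ^ 2)"
      by (subst sum.reindex) (auto intro: inj_onI simp: power2_eq_square)
    finally show ?thesis .
  qed
  have "lagrangian a G w
      = (\<Sum>K\<in>?C. (\<Prod>x\<in>K. w x) * (\<Sum>p\<in>open_pairs G K. w (fst p) * w (snd p)))"
    unfolding lagrangian_def
    by (rule sum.mono_neutral_right[OF finite_cliques[OF G] sub]) (simp add: vanish)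
  also have "\<dots> = (\<Sum>K\<in>?C. (\<Prod>x\<in>K. w x) * (\<Sum>u\<in>S - K. w u ^ 2))"
    by (intro sum.cong refl) (simp add: inner)
  finally show ?thesis using sum_squares_esym[OF fS w(2)] by simp
qed

text \<open>
  The Lagrangian for \<open>K\<^sub>r\<^sup>-\<close> of a clique on \<open>l\<close> vertices
  with all weights equal to \<open>1/l\<close>.  It is \<open>0\<close> for \<open>l < r -
  1\<close>, when the clique is too small for its blow-up to contain
  \<open>K\<^sub>r\<^sup>-\<close>.
\<close>
definition balanced_value :: "nat \<Rightarrow> nat \<Rightarrow> real" where
  "balanced_value r l = (real r - 1) * real (l choose (r - 1)) / real l ^ r"

lemma balanced_value_esym:
  assumes "l > 0" "r \<ge> 1"
  shows "real (l choose (r - 1)) * (1 / real l) ^ (r - 1) - real r * (real (l choose r) * (1 / real l) ^ r)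
    = balanced_value r l"
proof -
  obtain s where r: "r = Suc s" using assms(2) by (cases r) auto
  have "Suc s * (l choose Suc s) = (l choose s) * (l - s)"
    using binomial_absorption[of s l] binomial_absorb_comp[of l s]
    by (metis binomial_absorption mult.commute)
  then have *: "real (Suc s) * real (l choose Suc s) = real (l choose s) * real (l - s)"
    by (metis of_nat_mult)
  have **: "real (l choose s) * real (l - s) = real (l choose s) * (real l - real s)"
    by (cases "s \<le> l") (auto simp: binomial_eq_0 of_nat_diff)
  show ?thesis
    using assms(1) * ** unfolding r balanced_value_def
    by (simp add: power_divide divide_simps del: of_nat_Suc) (simp add: algebra_simps)
qed

text \<open>
  The Motzkin--Straus argument: a maximiser of minimal support lives on a clique and is constant
  there.
\<close>
lemma lagrangian_le_balanced:
  assumes G: "simple_graph G" and V: "verts G \<noteq> {}" and a: "a \<ge> 1"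
    and u: "u \<in> weightings (verts G)"
  obtains S where "clique G S" "S \<noteq> {}" "lagrangian a G u \<le> balanced_value (a + 2) (card S)"
proof -
  let ?V = "verts G" and ?L = "lagrangian a G"
  have fV: "finite ?V" using simple_graph_finite[OF G] .
  obtain w where w: "w \<in> weightings ?V" "\<And>u. u \<in> weightings ?V \<Longrightarrow> ?L u \<le> ?L w"
    and min: "\<And>u. u \<in> weightings ?V \<Longrightarrow> ?L w \<le> ?L u \<Longrightarrow>
       card (weight_support ?V w) \<le> card (weight_support ?V u)"
    using minimal_maximizer[OF G V] by blast
  define S where "S = weight_support ?V w"
  have SV: "S \<subseteq> ?V" and fS: "finite S" using fV by (auto simp: S_def weight_support_def)
  have w0: "0 \<le> w v" for v using w(1) by (simp add: weightings_def)
  have pos: "w v > 0" if "v \<in> S" for v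
    using that w0[of v] by (simp add: S_def weight_support_def)
  have out: "w v = 0" if "v \<notin> S" for v
    using that w(1) by (auto simp: S_def weight_support_def weightings_def)
  have sumS: "sum w S = 1"
    using sum.mono_neutral_left[OF fV SV, of w] out w(1) by (simp add: weightings_def)
  have no_emptying: False if "x \<in> S" "y \<in> S" "x \<noteq> y" "d = w y \<or> d = - w x"
    "?L w \<le> ?L (move_weight x y d w)" for x y d
  proof -
    have "move_weight x y d w \<in> weightings ?V"
      using that w0[of x] w0[of y] SV by (intro move_weight_weighting[OF w(1) fV]) auto
    then show False
      using min[OF _ that(5)] support_move_weight[OF fV _ _ that(3,4)] that(1,2)
      unfolding S_def by fastforce
  qed
  have cl: "clique G S"
    unfolding clique_def
  proof (intro conjI ballI impI SV)
    fix x y assume xy: "x \<in> S" "y \<in> S" "x \<noteq> y"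
    show "{x, y} \<in> edges G"
    proof (rule ccontr)
      assume "{x, y} \<notin> edges G"
      from lagrangian_move_weight_convex[where w = w and a = a, OF G w0 xy(3) this]
      obtain b c where bc: "0 \<le> c" "\<And>d. ?L (move_weight x y d w) = ?L w + b * d + c * d^2"
        by blast
      \<comment> \<open>A convex function has its maximum over an interval at one of the two ends.\<close>
      show False
      proof (cases "b \<ge> 0")
        case True
        then have "?L w \<le> ?L (move_weight x y (w y) w)" using bc w0[of y] by simp
        then show False using no_emptying xy by blast
      next
        case False
        then have "0 \<le> b * (- w x)" using w0[of x] by (simp add: mult_nonpos_nonneg)
        moreover have "0 \<le> c * (- w x)^2" using bc(1) by simp
        ultimately have "?L w \<le> ?L (move_weight x y (- w x) w)" unfolding bc(2) by linarith
        then show False using no_emptying xy by blast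
      qed
    qed
  qed
  have eq: "w x = w y" if xy: "x \<in> S" "y \<in> S" "x \<noteq> y" for x y
  proof (rule ccontr)
    assume ne: "w x \<noteq> w y"
    obtain b where b: "a = Suc b" using a by (cases a) auto
    let ?T = "S - {x, y}"
    define B where "B = esym ?T b w - (real a + 2) * esym ?T (Suc b) w"
    have L: "?L (move_weight x y d w) = ?L w + B * ((w x + d) * (w y - d) - w x * w y)" for d
    proof -
      let ?u = "move_weight x y d w"
      have T: "esym ?T j ?u = esym ?T j w" for j
        by (rule esym_cong) (auto simp: move_weight_def)
      have u: "?u x = w x + d" "?u y = w y - d" using xy(3) by (simp_all add: move_weight_simps)
      have TT: "S - {x} - {y} = ?T" by auto
      have "sum ?u S = (?u x + ?u y) + sum ?u ?T"
        using fS xy sum.remove[of S x ?u] sum.remove[of "S - {x}" y ?u] by (simp add: TT)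
      moreover have "sum w S = (w x + w y) + sum w ?T"
        using fS xy sum.remove[of S x w] sum.remove[of "S - {x}" y w] by (simp add: TT)
      moreover have "sum ?u ?T = sum w ?T"
        by (intro sum.cong) (auto simp: move_weight_def)
      ultimately have "sum ?u S = 1" using sumS u by simp
      moreover have "?u v = 0" if "v \<notin> S" for v
        using that xy out by (auto simp: move_weight_def)
      ultimately have "?L ?u = esym S (a + 1) ?u - (real a + 2) * esym S (a + 2) ?u"
        using lagrangian_on_clique[OF G cl] by blast
      moreover have "?L w = esym S (a + 1) w - (real a + 2) * esym S (a + 2) w"
        using lagrangian_on_clique[OF G cl] out sumS by blast
      ultimately show ?thesis
        using esym_two_points[OF fS xy, of b ?u] esym_two_points[OF fS xy, of "Suc b" ?u]
          esym_two_points[OF fS xy, of b w] esym_two_points[OF fS xy, of "Suc b" w]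
        unfolding b B_def by (simp add: T u algebra_simps)
    qed
    show False
    proof (cases "B \<le> 0")
      case True
      then have "?L w \<le> ?L (move_weight x y (w y) w)"
        unfolding L using w0[of x] w0[of y] by (simp add: mult_nonpos_nonneg mult_nonneg_nonneg)
      then show False using no_emptying xy by blast
    next
      case False
      \<comment> \<open>The step that makes the two weights equal.\<close>
    let ?d = "(w y - w x) / 2"
      have "(w x + ?d) * (w y - ?d) - w x * w y = ((w y - w x) / 2)^2"
        by (simp add: field_simps power2_eq_square)
      also have "\<dots> > 0" using ne by simp
      finally have "?L w < ?L (move_weight x y ?d w)" unfolding L using False by simp
      moreover have "move_weight x y ?d w \<in> weightings ?V"
        using w0[of x] w0[of y] xy SV by (intro move_weight_weighting[OF w(1) fV]) auto
      ultimately show False using w(2) by fastforce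
    qed
  qed
  have S0: "S \<noteq> {}" using sumS by auto
  then have l: "card S > 0" using fS by (simp add: card_gt_0_iff)
  obtain s where s: "s \<in> S" using S0 by blast
  have ws: "w v = w s" if "v \<in> S" for v using eq[OF that s] by (cases "v = s") auto
  have "sum w S = real (card S) * w s" using ws by simp
  then have "w s = 1 / real (card S)" using sumS l by (simp add: field_simps)
  then have "esym S j w = real (card S choose j) * (1 / real (card S)) ^ j" for j
    using esym_cong[of S w "\<lambda>_. w s" j] ws esym_const[OF fS, of j "w s"] by simp
  then have "?L w = balanced_value (a + 2) (card S)"
    using lagrangian_on_clique[OF G cl out sumS, of a] balanced_value_esym[OF l, of "a + 2"]
    by (simp add: add.commute)
  then show ?thesis by (intro that[OF cl S0]) (use w(2)[OF u] in simp)
qed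

section \<open>The optimal number of parts\<close>

lemma falling_product_nonneg:
  "0 \<le> real r * (real r - 1) * (real r - 2)"
  "0 \<le> real r * (real r - 1) * (real r - 2) * (real r - 3)"
proof -
  consider "r \<in> {0, 1, 2}" | "real r \<ge> 3" by fastforce
  then show "0 \<le> real r * (real r - 1) * (real r - 2)"
    "0 \<le> real r * (real r - 1) * (real r - 2) * (real r - 3)"
    by (cases; auto)+
qed

text \<open>
  Truncating the binomial expansion of \<open>(1 - y)\<^sup>r\<close> after a negative term gives
  a lower bound, and after a positive term an upper bound.
\<close>
lemma one_minus_power_lower:
  fixes y :: real
  assumes y: "0 \<le> y" "y \<le> 1"
  shows "1 - real r * y + real r * (real r - 1) / 2 * y ^ 2
    - real r * (real r - 1) * (real r - 2) / 6 * y ^ 3 \<le> (1 - y) ^ r"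
proof (induction r)
  case (Suc r)
  let ?R = "real r"
  have "1 - real (Suc r) * y + real (Suc r) * (real (Suc r) - 1) / 2 * y ^ 2
      - real (Suc r) * (real (Suc r) - 1) * (real (Suc r) - 2) / 6 * y ^ 3
    = (1 - y) * (1 - ?R * y + ?R * (?R - 1) / 2 * y ^ 2 - ?R * (?R - 1) * (?R - 2) / 6 * y ^ 3)
      - ?R * (?R - 1) * (?R - 2) / 6 * y ^ 4"
    by (simp add: field_simps power2_eq_square power3_eq_cube power4_eq_xxxx)
  also have "\<dots> \<le> (1 - y) * (1 - ?R * y + ?R * (?R - 1) / 2 * y ^ 2 - ?R * (?R - 1) * (?R - 2) / 6 * y ^ 3)"
    using falling_product_nonneg(1)[of r] y by simp
  also have "\<dots> \<le> (1 - y) * (1 - y) ^ r" using y Suc by (intro mult_left_mono) auto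
  finally show ?case by simp
qed simp

lemma one_minus_power_upper:
  fixes y :: real
  assumes y: "0 \<le> y" "y \<le> 1"
  shows "(1 - y) ^ r \<le> 1 - real r * y + real r * (real r - 1) / 2 * y ^ 2
    - real r * (real r - 1) * (real r - 2) / 6 * y ^ 3
    + real r * (real r - 1) * (real r - 2) * (real r - 3) / 24 * y ^ 4"
proof (induction r)
  case (Suc r)
  let ?R = "real r"
  let ?T = "1 - ?R * y + ?R * (?R - 1) / 2 * y ^ 2 - ?R * (?R - 1) * (?R - 2) / 6 * y ^ 3
      + ?R * (?R - 1) * (?R - 2) * (?R - 3) / 24 * y ^ 4"
  have "(1 - y) * (1 - y) ^ r \<le> (1 - y) * ?T" using y Suc by (intro mult_left_mono) auto
  also have "\<dots> \<le> (1 - y) * ?T + ?R * (?R - 1) * (?R - 2) * (?R - 3) / 24 * y ^ 5"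
    using falling_product_nonneg(2)[of r] y by simp
  also have "\<dots> = 1 - real (Suc r) * y + real (Suc r) * (real (Suc r) - 1) / 2 * y ^ 2
      - real (Suc r) * (real (Suc r) - 1) * (real (Suc r) - 2) / 6 * y ^ 3
      + real (Suc r) * (real (Suc r) - 1) * (real (Suc r) - 2) * (real (Suc r) - 3) / 24 * y ^ 4"
    by (simp add: field_simps power2_eq_square power3_eq_cube power4_eq_xxxx eval_nat_numeral)
  finally show ?case by simp
qed simp

text \<open>
  This reduces the comparison of consecutive values to that of \<open>1 - (r - 1) y\<close> with
  \<open>(1 - y)\<^sup>r\<close> at \<open>y = 1 / (l + 1)\<close>.
\<close>
lemma balanced_value_ratio:
  assumes l: "l \<ge> 1" "r \<ge> 1" "r \<le> l + 1"
  shows "balanced_value r (l + 1) * (1 - (real r - 1) / (real l + 1))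
    = balanced_value r l * (1 - 1 / (real l + 1)) ^ r"
proof -
  have "(l + 1 - (r - 1)) * (l + 1 choose (r - 1)) = (l + 1) * (l choose (r - 1))"
    using binomial_absorb_comp[of "l + 1" "r - 1"] by simp
  then have "real (l + 1 - (r - 1)) * real (l + 1 choose (r - 1)) = (real l + 1) * real (l choose (r - 1))"
    by (metis of_nat_mult of_nat_add of_nat_1)
  moreover have "real (l + 1 - (r - 1)) = real l + 1 - (real r - 1)"
    using l by (simp add: of_nat_diff)
  ultimately have C: "(real l + 1 - (real r - 1)) * real (l + 1 choose (r - 1))
      = (real l + 1) * real (l choose (r - 1))" by (simp only:)
  have "1 - (real r - 1) / (real l + 1) = (real l + 1 - (real r - 1)) / (real l + 1)"
    "1 - 1 / (real l + 1) = real l / (real l + 1)"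
    by (simp_all add: field_simps)
  then show ?thesis
    using C l unfolding balanced_value_def
    by (simp add: power_divide add.commute) (simp add: divide_simps mult_ac)
qed

text \<open>
  By the cubic lower bound it suffices that \<open>n\<^sup>2 \<le> C(r,2) n - C(r,3)\<close> for
  \<open>n = l + 1\<close>.  Here \<open>r \<le> n \<le> M = C(r,2) - (r - 1)/3\<close>, the
  second because \<open>l\<close> is an integer.  Subtracting \<open>(n - r) (M - n) \<ge>
  0\<close> leaves a linear condition that is tightest at \<open>n = M\<close>, where it holds
  with a surplus of \<open>(r - 1) (r + 2) / 18\<close>.
\<close>
lemma balanced_value_increasing:
  assumes r: "r \<ge> 3" and l: "l \<ge> 1" "6 * real l < (real r - 2) * (3 * real r + 1)"
  shows "balanced_value r l \<le> balanced_value r (l + 1)"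
proof (cases "r \<le> l + 1")
  case False
  then have "l choose (r - 1) = 0" by (simp add: binomial_eq_0)
  then have "balanced_value r l = 0" by (simp only: balanced_value_def)
  moreover have "0 \<le> balanced_value r (l + 1)" using r by (simp add: balanced_value_def)
  ultimately show ?thesis by simp
next
  case True
  let ?R = "real r"
  define n where "n = real l + 1"
  have n: "n > 0" "n \<ge> ?R" using True by (simp_all add: n_def)
  have "(real r - 2) * (3 * real r + 1) = real_of_int ((int r - 2) * (3 * int r + 1))" by simp
  then have "real_of_int (6 * int l) < real_of_int ((int r - 2) * (3 * int r + 1))" using l by simp
  then have "6 * int l < (int r - 2) * (3 * int r + 1)" by (simp only: of_int_less_iff)
  moreover have "even (6 * int l)" "even ((int r - 2) * (3 * int r + 1))" by simp_all
  \<comment> \<open>Both sides are even integers, so they differ by at least \<open>2\<close>.\<close>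
  moreover have "i + 2 \<le> j" if "i < j" "even i" "even j" for i j :: int
    using that by presburger
  ultimately have "6 * int l + 2 \<le> (int r - 2) * (3 * int r + 1)" by blast
  then have "real_of_int (6 * int l + 2) \<le> real_of_int ((int r - 2) * (3 * int r + 1))"
    by (simp only: of_int_le_iff)
  then have "6 * real l + 2 \<le> (?R - 2) * (3 * ?R + 1)" by simp
  define M where "M = (3 * ?R - 2) * (?R - 1) / 6"
  have nM: "n \<le> M" using \<open>6 * real l + 2 \<le> _\<close> by (simp add: n_def M_def algebra_simps)
  \<comment> \<open>The chord from \<open>r\<close> to \<open>M\<close>, the linear condition at \<open>M\<close>, and the surplus there.\<close>
  have "0 \<le> (n - ?R) * (M - n)" using n nM by simp
  moreover have "n * (2 * ?R + 1) \<le> M * (2 * ?R + 1)" using nM by (intro mult_right_mono) auto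
  moreover have "0 \<le> (?R - 1) * (?R + 2) / 18"  using r by simp
  ultimately have key: "n\<^sup>2 \<le> ?R * (?R - 1) / 2 * n - ?R * (?R - 1) * (?R - 2) / 6"
    unfolding M_def power2_eq_square by (simp add: field_simps)
  define y where "y = 1 / n"
  have y: "0 \<le> y" "y \<le> 1" using n r by (simp_all add: y_def)
  have "n ^ 2 * y ^ 3 \<le> (?R * (?R - 1) / 2 * n - ?R * (?R - 1) * (?R - 2) / 6) * y ^ 3"
    using key y by (intro mult_right_mono) auto
  moreover have "n ^ 2 * y ^ 3 = y" "n * y ^ 3 = y ^ 2"
    using n by (simp_all add: y_def power2_eq_square power3_eq_cube)
  ultimately have "y \<le> ?R * (?R - 1) / 2 * y ^ 2 - ?R * (?R - 1) * (?R - 2) / 6 * y ^ 3"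
    by (simp add: left_diff_distrib mult.assoc)
  moreover have "(?R - 1) * y = ?R * y - y" by (simp add: left_diff_distrib)
  ultimately have "1 - (?R - 1) * y \<le> (1 - y) ^ r"
    using one_minus_power_lower[OF y, of r] by linarith
  then have "balanced_value r l * (1 - (?R - 1) * y) \<le> balanced_value r l * (1 - y) ^ r"
    using r by (intro mult_left_mono) (auto simp: balanced_value_def)
  also have "\<dots> = balanced_value r (l + 1) * (1 - (?R - 1) * y)"
    using balanced_value_ratio[OF l(1) _ True] r by (simp add: y_def n_def)
  finally show ?thesis
  proof (rule mult_right_le_imp_le)
    show "0 < 1 - (?R - 1) * y" using n by (simp add: y_def field_simps)
  qed
qed

text \<open>
  By the quartic upper bound it suffices that \<open>n\<^sup>3 \<ge> C(r,2) n\<^sup>2 - C(r,3) n +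
  C(r,4)\<close> for \<open>n = l + 1\<close>, and the hypothesis on \<open>l\<close> says
  \<open>n \<ge> n\<^sub>0 = C(r,2) - (r - 2)/3\<close>.  At \<open>n\<^sub>0\<close> the
  expression \<open>n (n - C(r,2)) + C(r,3)\<close> equals \<open>(r - 2)\<^sup>2/9\<close>, and
  it grows from there on.
\<close>
lemma balanced_value_decreasing:
  assumes r: "r \<ge> 3" and l: "l \<ge> 1" "(real r - 2) * (3 * real r + 1) \<le> 6 * real l"
  shows "balanced_value r (l + 1) \<le> balanced_value r l"
proof -
  let ?R = "real r"
  have R: "?R \<ge> 3" using r by simp
  define n where "n = real l + 1"
  define n0 where "n0 = ?R * (?R - 1) / 2 - (?R - 2) / 3"
  have nn0: "n0 \<le> n" using l by (simp add: n_def n0_def field_simps)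
  have "(?R - 2) * 10 \<le> (?R - 2) * (3 * ?R + 1)" using R by (intro mult_left_mono) auto
  then have "10 * (?R - 2) \<le> 6 * real l" using l by linarith
  moreover have "x - 2 < y" if "10 * (x - 2) \<le> 6 * y" "3 \<le> x" for x y :: real
    using that by (simp add: field_simps)
  ultimately have "?R - 2 < real l" using R by blast
  then have rl: "r \<le> l + 1" by linarith
  have "?R - 1 \<le> ?R * (?R - 1) / 2"
    using mult_right_mono[of 2 ?R "?R - 1"] R by simp
  moreover have "0 < P - (?R - 2) / 3 \<and> P \<le> 2 * (P - (?R - 2) / 3)" if "?R - 1 \<le> P" for P
    using that R by (simp add: field_simps)
  ultimately have n0: "0 < n0" "?R * (?R - 1) / 2 \<le> 2 * n0"
    unfolding n0_def by blast+
  have n: "n > 0" "n \<ge> ?R" using rl by (simp_all add: n_def)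
  have "0 \<le> (n - n0) * (n + n0 - ?R * (?R - 1) / 2)" using nn0 n0 by (intro mult_nonneg_nonneg) auto
  then have g: "(?R - 2)^2 / 9 \<le> n * (n - ?R * (?R - 1) / 2) + ?R * (?R - 1) * (?R - 2) / 6"
    unfolding n0_def by (simp add: field_simps power2_eq_square)
  \<comment> \<open>The cubic \<open>3 r\<^sup>3 - 8 r\<^sup>2 + 29 r - 32\<close>, divided by \<open>r - 3\<close> with remainder.\<close>
  have "0 \<le> (?R - 3) * (3 * ?R * ?R + ?R + 32) + 64" using R by (simp add: mult_nonneg_nonneg)
  then have q: "?R * (?R - 1) / 2 * (?R - 3) / 4 \<le> n0 * ((?R - 2) / 3)" 
    unfolding n0_def by (simp add: field_simps power2_eq_square)
  have "?R * (?R - 1) * (?R - 2) * (?R - 3) / 24 = (?R * (?R - 1) / 2 * (?R - 3) / 4) * ((?R - 2) / 3)"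
    by (simp add: field_simps)
  also have "\<dots> \<le> (n0 * ((?R - 2) / 3)) * ((?R - 2) / 3)" using q R by (intro mult_right_mono) auto
  also have "\<dots> = n0 * ((?R - 2)^2 / 9)" by (simp add: power2_eq_square)
  also have "\<dots> \<le> n * ((?R - 2)^2 / 9)" using nn0 by (intro mult_right_mono) auto
  also have "\<dots> \<le> n * (n * (n - ?R * (?R - 1) / 2) + ?R * (?R - 1) * (?R - 2) / 6)"
    using g n by (intro mult_left_mono) auto
  finally have key: "?R * (?R - 1) / 2 * n ^ 2 - ?R * (?R - 1) * (?R - 2) / 6 * n
      + ?R * (?R - 1) * (?R - 2) * (?R - 3) / 24 \<le> n ^ 3"
    by (simp add: algebra_simps power2_eq_square power3_eq_cube)
  define y where "y = 1 / n"
  have y: "0 \<le> y" "y \<le> 1" using n r by (simp_all add: y_def)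
  have "(?R * (?R - 1) / 2 * n ^ 2 - ?R * (?R - 1) * (?R - 2) / 6 * n
      + ?R * (?R - 1) * (?R - 2) * (?R - 3) / 24) * y ^ 4 \<le> n ^ 3 * y ^ 4"
    using key y by (intro mult_right_mono) auto
  moreover have "n ^ 3 * y ^ 4 = y" "n ^ 2 * y ^ 4 = y ^ 2" "n * y ^ 4 = y ^ 3"
    using n by (simp_all add: y_def power2_eq_square power3_eq_cube power4_eq_xxxx)
  ultimately have "?R * (?R - 1) / 2 * y ^ 2 - ?R * (?R - 1) * (?R - 2) / 6 * y ^ 3
      + ?R * (?R - 1) * (?R - 2) * (?R - 3) / 24 * y ^ 4 \<le> y"
    by (simp add: left_diff_distrib distrib_right mult.assoc)
  then have "(1 - y) ^ r \<le> 1 - (?R - 1) * y"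
    using one_minus_power_upper[OF y, of r] by (simp add: algebra_simps)
  then have "balanced_value r l * (1 - y) ^ r \<le> balanced_value r l * (1 - (?R - 1) * y)"
    using r by (intro mult_left_mono) (auto simp: balanced_value_def)
  moreover have "balanced_value r (l + 1) * (1 - (?R - 1) * y) = balanced_value r l * (1 - y) ^ r"
    using balanced_value_ratio[OF l(1) _ rl] r by (simp add: y_def n_def)
  ultimately have "balanced_value r (l + 1) * (1 - (?R - 1) * y)
      \<le> balanced_value r l * (1 - (?R - 1) * y)" by simp
  then show ?thesis
  proof (rule mult_right_le_imp_le)
    show "0 < 1 - (?R - 1) * y" using n by (simp add: y_def field_simps)
  qed
qed

lemma balanced_value_le_optimum:
  assumes r: "r \<ge> 3" and t: "int t = \<lceil>(real r - 2) * (3 * real r + 1) / 6\<rceil>"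
    and l: "1 \<le> l" "l \<le> m"
  shows "balanced_value r l \<le> balanced_value r (min m t)"
proof -
  let ?v = "(real r - 2) * (3 * real r + 1)"
  have below: "6 * real i < ?v" if "i < t" for i
  proof -
    have "int i < \<lceil>?v / 6\<rceil>" using that t by simp
    then show ?thesis by (simp add: less_ceiling_iff)
  qed
  have above: "?v \<le> 6 * real i" if "t \<le> i" for i
  proof -
    have "\<lceil>?v / 6\<rceil> \<le> int i" using that t by simp
    then show ?thesis by (simp add: ceiling_le_iff)
  qed
  have "0 < ?v" using r by simp
  then have t1: "1 \<le> t" using above[of 0] by (cases t) auto
  show ?thesis
  proof (cases "l \<le> t")
    case True
    then have "l \<le> min m t" using l by simp
    then show ?thesis
    proof (induction rule: dec_induct)
      case (step i)
      then show ?case using balanced_value_increasing[OF r _ below, of i] l by simp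
    qed simp
  next
    case False
    then have "t \<le> l" by simp
    then have "balanced_value r l \<le> balanced_value r t"
    proof (induction rule: dec_induct)
      case (step i)
      then show ?case using balanced_value_decreasing[OF r _ above, of i] t1 by simp
    qed simp
    moreover have "min m t = t" using False l by simp
    ultimately show ?thesis by simp
  qed
qed

section \<open>Induced copies of a complete graph minus an edge\<close>

lemma verts_complete_minus_edge [simp]: "verts (complete_minus_edge r) = {..<r}"
  by (simp add: complete_minus_edge_def)

lemma edges_complete_minus_edge:
  "{i, j} \<in> edges (complete_minus_edge r) \<longleftrightarrow> i < r \<and> j < r \<and> i \<noteq> j \<and> {i, j} \<noteq> {0, 1}"
  by (auto simp: complete_minus_edge_def complete_simple_graph_def card_2_iff doubleton_eq_iff)

lemma doubleton_image_eq_iff: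
  assumes "inj_on f A" "i \<in> A" "j \<in> A" "k \<in> A" "l \<in> A"
  shows "{f i, f j} = {f k, f l} \<longleftrightarrow> {i, j} = {k, l}"
  using inj_on_image_eq_iff[OF assms(1), of "{i, j}" "{k, l}"] assms by simp

definition sole_nonedge :: "'a graph \<Rightarrow> 'a set \<Rightarrow> 'a \<Rightarrow> 'a \<Rightarrow> bool" where
  "sole_nonedge H S x y \<longleftrightarrow> x \<in> S \<and> y \<in> S \<and> x \<noteq> y \<and>
     (\<forall>u\<in>S. \<forall>v\<in>S. u \<noteq> v \<longrightarrow> ({u, v} \<in> edges H \<longleftrightarrow> {u, v} \<noteq> {x, y}))"

lemma sole_nonedgeD:
  assumes "sole_nonedge H S x y"
  shows "x \<in> S" "y \<in> S" "x \<noteq> y"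
    "u \<in> S \<Longrightarrow> v \<in> S \<Longrightarrow> u \<noteq> v \<Longrightarrow> {u, v} \<in> edges H \<longleftrightarrow> {u, v} \<noteq> {x, y}"
  using assms by (simp_all only: sole_nonedge_def) simp_all

text \<open>
  Vertices \<open>0\<close> and \<open>1\<close> go to the two ends of the missing edge, and the
  others may go anywhere, because everything else is adjacent.
\<close>
lemma complete_minus_edge_iso_iff:
  assumes H: "finite (verts H)" "card (verts H) = r" "\<And>x. {x} \<notin> edges H" and r: "r \<ge> 2"
  shows "graph_iso (complete_minus_edge r) H \<longleftrightarrow> (\<exists>x y. sole_nonedge H (verts H) x y)"
proof
  assume "graph_iso (complete_minus_edge r) H"
  then obtain f where f: "bij_betw f {..<r} (verts H)"
    and e: "\<And>i j. i < r \<Longrightarrow> j < r \<Longrightarrow> {i, j} \<in> edges (complete_minus_edge r) \<longleftrightarrow> {f i, f j} \<in> edges H"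
    by (auto simp: graph_iso_def)
  have inj: "f i = f j \<longleftrightarrow> i = j" if "i < r" "j < r" for i j
    using f that by (auto simp: bij_betw_def inj_on_def)
  have img: "verts H = f ` {..<r}" using f by (simp add: bij_betw_def)
  have "sole_nonedge H (verts H) (f 0) (f 1)"
    unfolding sole_nonedge_def
  proof (intro conjI ballI impI)
    show "f 0 \<in> verts H" "f 1 \<in> verts H" "f 0 \<noteq> f 1" using r img inj[of 0 1] by auto
    fix u v assume "u \<in> verts H" "v \<in> verts H" "u \<noteq> v"
    then obtain i j where ij: "u = f i" "v = f j" "i < r" "j < r" "i \<noteq> j" using img by auto
    have "{u, v} = {f 0, f 1} \<longleftrightarrow> {i, j} = {0, 1}"
      unfolding ij(1,2) using f ij r by (intro doubleton_image_eq_iff[of f "{..<r}"]) (auto simp: bij_betw_def)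
    then show "{u, v} \<in> edges H \<longleftrightarrow> {u, v} \<noteq> {f 0, f 1}"
      using e[OF ij(3,4)] ij(3-5) unfolding edges_complete_minus_edge ij(1,2) by argo
  qed
  then show "\<exists>x y. sole_nonedge H (verts H) x y" by (intro exI)
next
  assume "\<exists>x y. sole_nonedge H (verts H) x y"
  then obtain x y where "sole_nonedge H (verts H) x y" by (elim exE)
  note xy = sole_nonedgeD(1-3)[OF this] and e = sole_nonedgeD(4)[OF this]
  have "card (verts H - {x, y}) = card {2..<r}"
    using xy H by (simp add: card_Diff_subset)
  then obtain g where g: "bij_betw g {2..<r} (verts H - {x, y})"
    using finite_same_card_bij[of "{2..<r}" "verts H - {x, y}"] H by auto
  define f where "f i = (if i = 0 then x else if i = 1 then y else g i)" for i :: nat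
  have "bij_betw f {0, 1} {x, y}" using xy by (auto simp: bij_betw_def f_def)
  moreover have "bij_betw f {2..<r} (verts H - {x, y})"
    using g by (rule bij_betw_cong[THEN iffD1, rotated]) (auto simp: f_def)
  ultimately have "bij_betw f ({0, 1} \<union> {2..<r}) ({x, y} \<union> (verts H - {x, y}))"
    by (rule bij_betw_combine) auto
  moreover have "{0, 1} \<union> {2..<r} = {..<r}" using r by auto
  moreover have "{x, y} \<union> (verts H - {x, y}) = verts H" using xy by auto
  ultimately have f: "bij_betw f {..<r} (verts H)" by simp
  have inj: "f i = f j \<longleftrightarrow> i = j" if "i < r" "j < r" for i j
    using f that by (auto simp: bij_betw_def inj_on_def)
  have f01: "f 0 = x" "f 1 = y" by (simp_all add: f_def)
  show "graph_iso (complete_minus_edge r) H"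
    unfolding graph_iso_def
  proof (intro exI[of _ f] conjI ballI)
    show "bij_betw f (verts (complete_minus_edge r)) (verts H)" using f by simp
    fix i j assume "i \<in> verts (complete_minus_edge r)" "j \<in> verts (complete_minus_edge r)"
    then have ij: "i < r" "j < r" by simp_all
    then have V: "f i \<in> verts H" "f j \<in> verts H" using f by (auto simp: bij_betw_def)
    show "{i, j} \<in> edges (complete_minus_edge r) \<longleftrightarrow> {f i, f j} \<in> edges H"
    proof (cases "i = j")
      case True
      then show ?thesis using H(3) edges_complete_minus_edge[of i j r] by simp
    next
      case False
      have "{f i, f j} = {f 0, f 1} \<longleftrightarrow> {i, j} = {0, 1}"
        using f ij r by (intro doubleton_image_eq_iff[of f "{..<r}"]) (auto simp: bij_betw_def)
      moreover have "f i \<noteq> f j" using inj[OF ij] False by simp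
      ultimately show ?thesis
        using e[OF V] False ij unfolding edges_complete_minus_edge f01 by argo
    qed
  qed
qed

lemma lagrangian_uniform:
  assumes G: "simple_graph G"
  defines "n \<equiv> card (verts G)"
  shows "lagrangian a G (\<lambda>v. if v \<in> verts G then 1 / real n else 0)
    = real (card (SIGMA K : cliques G a. open_pairs G K)) / real n ^ (a + 2)"
proof -
  let ?w = "\<lambda>v. if v \<in> verts G then 1 / real n else 0"
  have "(\<Prod>x\<in>K. ?w x) * (\<Sum>p\<in>open_pairs G K. ?w (fst p) * ?w (snd p))
      = real (card (open_pairs G K)) / real n ^ (a + 2)" if K: "K \<in> cliques G a" for K
  proof -
    have "(\<Prod>x\<in>K. ?w x) = (\<Prod>x\<in>K. 1 / real n)"
      using K by (intro prod.cong) (auto simp: cliques_def clique_def)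
    also have "\<dots> = (1 / real n) ^ a" using K by (simp add: cliques_def)
    finally have 1: "(\<Prod>x\<in>K. ?w x) = (1 / real n) ^ a" .
    have "(\<Sum>p\<in>open_pairs G K. ?w (fst p) * ?w (snd p)) = (\<Sum>p\<in>open_pairs G K. 1 / real n * (1 / real n))"
      by (intro sum.cong) (auto simp: open_pairs_def common_nbrs_def)
    then show ?thesis unfolding 1 by (simp add: power_add power_divide power2_eq_square)
  qed
  then show ?thesis
    unfolding lagrangian_def
    using finite_cliques[OF G] finite_open_pairs[OF G]
    by (simp add: sum_divide_distrib[symmetric] cong: sum.cong)
qed

text \<open>
  Each copy gives a clique (the copy without its two non-adjacent vertices) and an open pair, in
  two orders.  The inequality may be strict, as the right-hand side also counts the diagonal
  pairs.
\<close>
lemma induced_count_le_lagrangian: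
  assumes G: "simple_graph G" and V: "verts G \<noteq> {}"
  defines "n \<equiv> card (verts G)"
  shows "2 * real (induced_count (complete_minus_edge (a + 2)) G)
    \<le> real n ^ (a + 2) * lagrangian a G (\<lambda>v. if v \<in> verts G then 1 / real n else 0)"
proof -
  let ?T = "SIGMA K : cliques G a. open_pairs G K"
  define C where "C = {S. S \<subseteq> verts G \<and> card S = a + 2 \<and>
     graph_iso (complete_minus_edge (a + 2)) (induced_subgraph G S)}"
  have "\<exists>x y. x \<noteq> y \<and> x \<in> S \<and> y \<in> S \<and> (S - {x, y}, (x, y)) \<in> ?T \<and> (S - {x, y}, (y, x)) \<in> ?T"
    if S: "S \<in> C" for S
  proof -
    have S': "S \<subseteq> verts G" "card S = a + 2" "finite S"
      using S simple_graph_finite[OF G] by (auto simp: C_def intro: finite_subset)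
    define H where "H = induced_subgraph G S"
    have H: "verts H = S" "\<And>x. {x} \<notin> edges H"
      and EH: "\<And>u v. u \<in> S \<Longrightarrow> v \<in> S \<Longrightarrow> {u, v} \<in> edges H \<longleftrightarrow> {u, v} \<in> edges G"
      using simple_graph_no_loop[OF G] by (simp_all add: H_def induced_subgraph_def)
    have "graph_iso (complete_minus_edge (a + 2)) H" using S by (simp add: C_def H_def)
    then obtain x y where "sole_nonedge H S x y"
      using complete_minus_edge_iso_iff[of H "a + 2"] H S' by auto
    note xy = sole_nonedgeD(1-3)[OF this] and eH = sole_nonedgeD(4)[OF this]
    have e: "{u, v} \<in> edges G \<longleftrightarrow> {u, v} \<noteq> {x, y}" if "u \<in> S" "v \<in> S" "u \<noteq> v" for u v
      using eH[OF that] EH[OF that(1,2)] by argo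
    have e': "{u, v} \<in> edges G" if "u \<in> S - {x, y}" "v \<in> S" "u \<noteq> v" for u v
    proof -
      have "{u, v} \<noteq> {x, y}" using that(1) by (metis Diff_iff insertI1)
      then show ?thesis using e[of u v] that by simp
    qed
    have "S - {x, y} \<in> cliques G a"
      using S' xy e' by (auto simp: cliques_def clique_def card_Diff_subset)
    moreover have "x \<in> common_nbrs G (S - {x, y})" "y \<in> common_nbrs G (S - {x, y})"
      using S' xy e' by (auto simp: common_nbrs_def)
    moreover have "{x, y} \<notin> edges G" using e[OF xy] by simp
    moreover have "{y, x} \<notin> edges G" using calculation(4) by (simp only: insert_commute[of y x] simp_thms)
    ultimately show ?thesis using xy by (intro exI[of _ x] exI[of _ y]) (auto simp: open_pairs_def)
  qed
  then obtain f g where fg: "\<And>S. S \<in> C \<Longrightarrow> f S \<noteq> g S \<and> f S \<in> S \<and> g S \<in> S \<and>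
      (S - {f S, g S}, (f S, g S)) \<in> ?T \<and> (S - {f S, g S}, (g S, f S)) \<in> ?T"
    by metis
  \<comment> \<open>Each copy is recorded once for either order of its missing edge.\<close>
  define \<phi> where "\<phi> = (\<lambda>(S, b). (S - {f S, g S}, if b then (f S, g S) else (g S, f S)))"
  have "inj_on \<phi> (C \<times> UNIV)"
  proof (rule inj_onI)
    fix p q assume p: "p \<in> C \<times> (UNIV :: bool set)" and q: "q \<in> C \<times> UNIV" and eq: "\<phi> p = \<phi> q"
    obtain S b where [simp]: "p = (S, b)" by (cases p)
    obtain S' b' where [simp]: "q = (S', b')" by (cases q)
    have recover: "S = fst (\<phi> (S, b)) \<union> {fst (snd (\<phi> (S, b))), snd (snd (\<phi> (S, b)))}" if "S \<in> C" for S b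
      using fg[OF that] by (auto simp: \<phi>_def)
    have "S = S'" using recover[of S b] recover[of S' b'] p q eq by simp
    then show "p = q" using eq fg[of S] p by (auto simp: \<phi>_def split: if_splits)
  qed
  moreover have "\<phi> ` (C \<times> UNIV) \<subseteq> ?T" using fg by (auto simp: \<phi>_def)
  moreover have "finite ?T"
    using finite_cliques[OF G] finite_open_pairs[OF G] by (intro finite_SigmaI)
  ultimately have "card (C \<times> (UNIV :: bool set)) \<le> card ?T" by (rule card_inj_on_le)
  moreover have "card C = induced_count (complete_minus_edge (a + 2)) G"
    by (simp add: C_def induced_count_def)
  moreover have "n > 0" using V simple_graph_finite[OF G] by (simp add: n_def card_gt_0_iff)
  ultimately show ?thesis
    using lagrangian_uniform[OF G, of a] unfolding n_def[symmetric]
    by (simp add: card_cartesian_product mult.commute)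
qed

lemma clique_contains_complete:
  assumes S: "clique G S" "finite S" "k \<le> card S"
  shows "contains_subgraph G (complete_simple_graph k)"
proof -
  obtain T where T: "T \<subseteq> S" "card T = k" using obtain_subset_with_card_n[OF S(3)] by metis
  have "finite T" using T S finite_subset by blast
  then obtain f where f: "bij_betw f {..<k} T"
    using finite_same_card_bij[of "{..<k}" T] T by auto
  then have fT: "inj_on f {..<k}" "f ` {..<k} = T" by (simp_all add: bij_betw_def)
  show ?thesis
    unfolding contains_subgraph_def complete_simple_graph_def
  proof (intro exI[of _ f] conjI ballI)
    fix e assume "e \<in> edges ({..<k}, {e. e \<subseteq> {..<k} \<and> card e = 2})"
    then obtain i j where ij: "e = {i, j}" "i \<noteq> j" "i < k" "j < k"
      by (auto simp: card_2_iff)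
    then have "f i \<noteq> f j" "f i \<in> S" "f j \<in> S" using fT T by (auto simp: inj_on_def)
    then show "f ` e \<in> edges G" using S(1) ij by (auto simp: clique_def)
  qed (use fT T S in \<open>auto simp: clique_def\<close>)
qed

lemma induced_count_le_balanced:
  assumes G: "simple_graph G" "verts G \<noteq> {}" "\<not> contains_subgraph G (complete_simple_graph k)"
    and r: "r \<ge> 3"
  obtains l where "1 \<le> l" "l < k"
    "2 * real (induced_count (complete_minus_edge r) G) \<le> real (card (verts G)) ^ r * balanced_value r l"
proof -
  obtain a where a: "r = a + 2" "a \<ge> 1" using r that[of "r - 2"] by auto
  let ?n = "card (verts G)"
  let ?w = "\<lambda>v. if v \<in> verts G then 1 / real ?n else 0"
  have n: "?n > 0" using G simple_graph_finite by (simp add: card_gt_0_iff)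
  then have "?w \<in> weightings (verts G)" by (simp add: weightings_def)
  then obtain S where S: "clique G S" "S \<noteq> {}" "lagrangian a G ?w \<le> balanced_value r (card S)"
    using lagrangian_le_balanced[OF G(1,2) a(2)] a(1) by metis
  have fS: "finite S" using S simple_graph_finite[OF G(1)] by (auto simp: clique_def intro: finite_subset)
  show ?thesis
  proof (rule that[of "card S"])
    show "1 \<le> card S" using S fS by (simp add: Suc_le_eq card_gt_0_iff)
    show "card S < k" using clique_contains_complete[OF S(1) fS, of k] G(3) by (meson not_le)
    have "2 * real (induced_count (complete_minus_edge r) G) \<le> real ?n ^ r * lagrangian a G ?w"
      using induced_count_le_lagrangian[OF G(1,2), of a] a by simp
    also have "\<dots> \<le> real ?n ^ r * balanced_value r (card S)" using S(3) by (intro mult_left_mono) auto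
    finally show "2 * real (induced_count (complete_minus_edge r) G) \<le> real ?n ^ r * balanced_value r (card S)" .
  qed
qed

section \<open>Copies in complete multipartite graphs\<close>

definition colour_graph :: "'a set \<Rightarrow> ('a \<Rightarrow> nat) \<Rightarrow> 'a graph" where
  "colour_graph V c = (V, {{u, v} | u v. u \<in> V \<and> v \<in> V \<and> c u \<noteq> c v})"

lemma verts_colour_graph [simp]: "verts (colour_graph V c) = V"
  by (simp add: colour_graph_def)

lemma edges_colour_graph:
  assumes "u \<in> V" "v \<in> V"
  shows "{u, v} \<in> edges (colour_graph V c) \<longleftrightarrow> c u \<noteq> c v"
  using assms by (auto simp: colour_graph_def doubleton_eq_iff)

lemma simple_colour_graph: "finite V \<Longrightarrow> simple_graph (colour_graph V c)"
  by (auto simp: simple_graph_def colour_graph_def card_2_iff)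

lemma induced_colour_graph: "S \<subseteq> V \<Longrightarrow> induced_subgraph (colour_graph V c) S = colour_graph S c"
  by (auto simp: induced_subgraph_def colour_graph_def)

lemma colour_graph_cong: "(\<And>v. v \<in> V \<Longrightarrow> c v = d v) \<Longrightarrow> colour_graph V c = colour_graph V d"
  unfolding colour_graph_def by (intro prod_eqI Collect_cong) (auto, metis+)

lemma colour_graph_clique_free:
  assumes c: "c \<in> V \<rightarrow> {..<l}" and l: "l < k"
  shows "\<not> contains_subgraph (colour_graph V c) (complete_simple_graph k)"
proof
  assume "contains_subgraph (colour_graph V c) (complete_simple_graph k)"
  then obtain f where f: "inj_on f {..<k}" "f ` {..<k} \<subseteq> V"
    and e: "\<And>e. e \<subseteq> {..<k} \<Longrightarrow> card e = 2 \<Longrightarrow> f ` e \<in> edges (colour_graph V c)"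
    by (auto simp: contains_subgraph_def complete_simple_graph_def)
  have "inj_on (\<lambda>i. c (f i)) {..<k}"
  proof (rule inj_onI, rule ccontr)
    fix i j assume ij: "i \<in> {..<k}" "j \<in> {..<k}" "c (f i) = c (f j)" "i \<noteq> j"
    then have "{f i, f j} \<in> edges (colour_graph V c)" using e[of "{i, j}"] by simp
    then show False using edges_colour_graph[of "f i" V "f j" c] ij f by auto
  qed
  moreover have "(\<lambda>i. c (f i)) ` {..<k} \<subseteq> {..<l}" using c f by auto
  ultimately have "card {..<k} \<le> card {..<l}" by (intro card_inj_on_le) auto
  then show False using l by simp
qed

definition sole_collision :: "'a set \<Rightarrow> ('a \<Rightarrow> nat) \<Rightarrow> 'a set \<Rightarrow> bool" where
  "sole_collision S c e \<longleftrightarrow> (\<forall>u\<in>S. \<forall>v\<in>S. u \<noteq> v \<longrightarrow> (c u = c v \<longleftrightarrow> {u, v} = e))"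

lemma sole_collisionD:
  "sole_collision S c e \<Longrightarrow> u \<in> S \<Longrightarrow> v \<in> S \<Longrightarrow> u \<noteq> v \<Longrightarrow> c u = c v \<longleftrightarrow> {u, v} = e"
  by (simp add: sole_collision_def)

lemma complete_minus_edge_iso_colour_graph:
  assumes S: "finite S" "card S = r" and r: "r \<ge> 2"
  shows "graph_iso (complete_minus_edge r) (colour_graph S c) \<longleftrightarrow>
    (\<exists>e. e \<subseteq> S \<and> card e = 2 \<and> sole_collision S c e)"
proof -
  have 1: "graph_iso (complete_minus_edge r) (colour_graph S c) \<longleftrightarrow>
      (\<exists>x y. sole_nonedge (colour_graph S c) S x y)"
    using complete_minus_edge_iso_iff[of "colour_graph S c" r] S r
      simple_graph_no_loop[OF simple_colour_graph[OF S(1)]] by simp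
  have 2: "sole_nonedge (colour_graph S c) S x y \<longleftrightarrow>
      x \<in> S \<and> y \<in> S \<and> x \<noteq> y \<and> sole_collision S c {x, y}" for x y
    unfolding sole_nonedge_def sole_collision_def
    by (intro conj_cong refl ball_cong) (simp only: edges_colour_graph, argo)
  have 3: "(\<exists>x y. x \<in> S \<and> y \<in> S \<and> x \<noteq> y \<and> sole_collision S c {x, y}) \<longleftrightarrow>
      (\<exists>e. e \<subseteq> S \<and> card e = 2 \<and> sole_collision S c e)"
  proof (intro iffI; elim exE conjE)
    fix x y assume "x \<in> S" "y \<in> S" "x \<noteq> y" "sole_collision S c {x, y}"
    then show "\<exists>e. e \<subseteq> S \<and> card e = 2 \<and> sole_collision S c e"
      by (intro exI[of _ "{x, y}"]) simp
  next
    fix e assume e: "e \<subseteq> S" "card e = 2" "sole_collision S c e"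
    then obtain x y where "e = {x, y}" "x \<noteq> y" unfolding card_2_iff by (elim exE conjE)
    then show "\<exists>x y. x \<in> S \<and> y \<in> S \<and> x \<noteq> y \<and> sole_collision S c {x, y}"
      using e by (intro exI[of _ x] exI[of _ y]) simp
  qed
  show ?thesis unfolding 1 2 3 ..
qed

lemma card_inj_PiE:
  assumes S: "finite S" and L: "finite L"
  shows "card {f \<in> S \<rightarrow>\<^sub>E L. inj_on f S} = fact (card S) * (card L choose card S)"
  using S
proof (induction S rule: finite_induct)
  case empty
  then show ?case by (simp add: PiE_empty_domain)
next
  case (insert x S)
  let ?I = "{f \<in> S \<rightarrow>\<^sub>E L. inj_on f S}"
  let ?ext = "\<lambda>(f, y). f(x := y)"
  have fin: "finite ?I" using insert(1) L by (intro finite_subset[OF _ finite_PiE[of S "\<lambda>_. L"]]) auto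
  have "bij_betw ?ext (SIGMA f : ?I. L - f ` S) {f \<in> insert x S \<rightarrow>\<^sub>E L. inj_on f (insert x S)}"
  proof (rule bij_betw_byWitness[where f' = "\<lambda>g. (restrict g S, g x)"])
    show "\<forall>p\<in>SIGMA f : ?I. L - f ` S. (restrict (?ext p) S, ?ext p x) = p"
      using insert(2) by (auto simp: PiE_def extensional_def restrict_def fun_eq_iff)
    show "\<forall>g\<in>{f \<in> insert x S \<rightarrow>\<^sub>E L. inj_on f (insert x S)}. ?ext (restrict g S, g x) = g"
      by (auto simp: PiE_def extensional_def restrict_def fun_eq_iff)
    show "?ext ` (SIGMA f : ?I. L - f ` S) \<subseteq> {f \<in> insert x S \<rightarrow>\<^sub>E L. inj_on f (insert x S)}"
    proof
      fix g assume "g \<in> ?ext ` (SIGMA f : ?I. L - f ` S)"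
      then obtain f y where f: "g = f(x := y)" "f \<in> S \<rightarrow>\<^sub>E L" "inj_on f S" "y \<in> L" "y \<notin> f ` S"
        by auto
      have "inj_on g (insert x S)"
        using f insert(2) by (auto simp: inj_on_fun_updI)
      then show "g \<in> {f \<in> insert x S \<rightarrow>\<^sub>E L. inj_on f (insert x S)}"
        unfolding f(1) using PiE_fun_upd[of y "\<lambda>_. L" x f S] f by simp
    qed
    show "(\<lambda>g. (restrict g S, g x)) ` {f \<in> insert x S \<rightarrow>\<^sub>E L. inj_on f (insert x S)}
        \<subseteq> (SIGMA f : ?I. L - f ` S)"
      using insert(2) by (auto simp: inj_on_def)
  qed
  then have "card {f \<in> insert x S \<rightarrow>\<^sub>E L. inj_on f (insert x S)} = card (SIGMA f : ?I. L - f ` S)"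
    by (rule bij_betw_same_card[symmetric])
  also have "\<dots> = (\<Sum>f\<in>?I. card L - card S)"
    unfolding card_SigmaI[OF fin ballI[OF finite_Diff[OF L]]]
  proof (rule sum.cong[OF refl])
    fix f assume f: "f \<in> ?I"
    then have "f ` S \<subseteq> L" "card (f ` S) = card S" by (auto intro: card_image)
    then show "card (L - f ` S) = card L - card S"
      using insert(1) by (subst card_Diff_subset) auto
  qed
  also have "\<dots> = fact (card S) * ((card L - card S) * (card L choose card S))"
    using insert.IH by simp
  also have "(card L - card S) * (card L choose card S) = Suc (card S) * (card L choose Suc (card S))"
    by (metis binomial_absorb_comp binomial_absorption)
  finally show ?case using insert(1,2) by (simp add: algebra_simps)
qed

text \<open>
  Deleting one of the two points of the pair \<open>e\<close> turns such a colouring into an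
  injective one, and the colour of the deleted point can be recovered.
\<close>
lemma card_sole_collision:
  assumes S: "finite S" "e \<subseteq> S" "card e = 2" and L: "finite L"
  shows "card {c \<in> S \<rightarrow>\<^sub>E L. sole_collision S c e} = fact (card S - 1) * (card L choose (card S - 1))"
proof -
  obtain x y where xy: "e = {x, y}" "x \<noteq> y" using S(3) by (auto simp: card_2_iff)
  then have xyS: "x \<in> S" "y \<in> S" using S by auto
  let ?T = "S - {y}"
  have sole: "sole_collision S c e \<longleftrightarrow> inj_on c ?T \<and> c x = c y" for c :: "'a \<Rightarrow> nat"
  proof
    assume s: "sole_collision S c e"
    have "inj_on c ?T"
    proof (rule inj_onI, rule ccontr)
      fix u v assume uv: "u \<in> ?T" "v \<in> ?T" "c u = c v" "u \<noteq> v"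
      then have "{u, v} = e" using sole_collisionD[OF s, of u v] by simp
      then show False using uv xy by auto
    qed
    then show "inj_on c ?T \<and> c x = c y" using sole_collisionD[OF s xyS xy(2)] xy(1) by simp
  next
    assume c: "inj_on c ?T \<and> c x = c y"
    have *: "c u = c v \<longleftrightarrow> {u, v} = e" if "u \<in> ?T" "v \<in> S" "u \<noteq> v" for u v
    proof (cases "v = y")
      case True
      then have "c u = c v \<longleftrightarrow> u = x" using c that xyS xy(2) by (metis Diff_iff inj_on_eq_iff singletonD)
      then show ?thesis using True xy that(3) by (auto simp: doubleton_eq_iff)
    next
      case False
      then have "c u \<noteq> c v" using c that by (auto simp: inj_on_def)
      moreover have "{u, v} \<noteq> e" using that False xy by auto
      ultimately show ?thesis by simp
    qed
    show "sole_collision S c e"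
      unfolding sole_collision_def
    proof (intro ballI impI)
      fix u v assume uv: "u \<in> S" "v \<in> S" "u \<noteq> v"
      show "c u = c v \<longleftrightarrow> {u, v} = e"
      proof (cases "u = y")
        case True
        then have "c v = c u \<longleftrightarrow> {v, u} = e" using *[of v u] uv by auto
        then show ?thesis by (simp only: insert_commute[of u v] eq_commute[of "c u"])
      next
        case False
        then show ?thesis using *[of u v] uv by simp
      qed
    qed
  qed
  have "bij_betw (\<lambda>c. restrict c ?T) {c \<in> S \<rightarrow>\<^sub>E L. sole_collision S c e} {d \<in> ?T \<rightarrow>\<^sub>E L. inj_on d ?T}"
  proof (rule bij_betw_byWitness[where f' = "\<lambda>d. d(y := d x)"])
    show "\<forall>c\<in>{c \<in> S \<rightarrow>\<^sub>E L. sole_collision S c e}. (restrict c ?T)(y := restrict c ?T x) = c"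
      unfolding sole using xy(2) xyS by (auto simp: PiE_def extensional_def restrict_def fun_eq_iff)
    show "\<forall>d\<in>{d \<in> ?T \<rightarrow>\<^sub>E L. inj_on d ?T}. restrict (d(y := d x)) ?T = d"
      by (auto simp: PiE_def extensional_def restrict_def fun_eq_iff)
    show "(\<lambda>c. restrict c ?T) ` {c \<in> S \<rightarrow>\<^sub>E L. sole_collision S c e} \<subseteq> {d \<in> ?T \<rightarrow>\<^sub>E L. inj_on d ?T}"
      unfolding sole by (auto simp: inj_on_def PiE_iff split: if_splits)
    show "(\<lambda>d. d(y := d x)) ` {d \<in> ?T \<rightarrow>\<^sub>E L. inj_on d ?T} \<subseteq> {c \<in> S \<rightarrow>\<^sub>E L. sole_collision S c e}"
      unfolding sole using xy(2) xyS by (auto simp: inj_on_def PiE_def extensional_def)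
  qed
  then have "card {c \<in> S \<rightarrow>\<^sub>E L. sole_collision S c e} = card {d \<in> ?T \<rightarrow>\<^sub>E L. inj_on d ?T}"
    by (rule bij_betw_same_card)
  also have "\<dots> = fact (card S - 1) * (card L choose (card S - 1))"
    using card_inj_PiE[of ?T L] S L xyS by simp
  finally show ?thesis .
qed

text \<open>
  The number of colourings of \<open>r\<close> points with \<open>l\<close> colours in which
  exactly one pair of points shares a colour: choose the pair, then colour injectively.
\<close>
definition good_colourings :: "nat \<Rightarrow> nat \<Rightarrow> nat" where
  "good_colourings r l = (r choose 2) * (fact (r - 1) * (l choose (r - 1)))"

lemma card_good_colourings:
  assumes S: "finite S" "card S = r" and r: "r \<ge> 3"
  shows "card {c \<in> S \<rightarrow>\<^sub>E {..<l}. graph_iso (complete_minus_edge r) (colour_graph S c)} = good_colourings r l"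
proof -
  let ?E = "{e. e \<subseteq> S \<and> card e = 2}"
  let ?A = "\<lambda>e. {c \<in> S \<rightarrow>\<^sub>E {..<l}. sole_collision S c e}"
  have finA: "finite (?A e)" for e
    using finite_PiE[of S "\<lambda>_. {..<l}"] S(1) by simp
  have "{c \<in> S \<rightarrow>\<^sub>E {..<l}. graph_iso (complete_minus_edge r) (colour_graph S c)} = (\<Union>e\<in>?E. ?A e)"
    using complete_minus_edge_iso_colour_graph[OF S] r by auto
  moreover have "?A e \<inter> ?A e' = {}" if e: "e \<in> ?E" "e' \<in> ?E" "e \<noteq> e'" for e e'
  proof (rule ccontr)
    assume "?A e \<inter> ?A e' \<noteq> {}"
    then obtain c where c: "sole_collision S c e" "sole_collision S c e'" by auto
    have "card e = 2" using e(1) by simp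
    then obtain x y where xy: "e = {x, y}" "x \<noteq> y" unfolding card_2_iff by (elim exE conjE)
    then have "x \<in> S" "y \<in> S" using e(1) by auto
    then show False
      using sole_collisionD[OF c(1) _ _ xy(2)] sole_collisionD[OF c(2) _ _ xy(2)] xy e(3) by simp
  qed
  ultimately have "card {c \<in> S \<rightarrow>\<^sub>E {..<l}. graph_iso (complete_minus_edge r) (colour_graph S c)}
      = (\<Sum>e\<in>?E. card (?A e))"
    using S(1) finA by (simp only:) (intro card_UN_disjoint, auto)
  also have "\<dots> = (\<Sum>e\<in>?E. fact (r - 1) * (l choose (r - 1)))"
    using card_sole_collision[OF S(1), of _ "{..<l}"] S(2) by (intro sum.cong) auto
  finally show ?thesis by (simp add: n_subsets[OF S(1)] S(2) good_colourings_def)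
qed

lemma good_colourings_balanced_value:
  assumes "r \<ge> 1"
  shows "real (good_colourings r l) / real l ^ r = fact r / 2 * balanced_value r l"
proof -
  have "even r \<or> even (r - 1)" by presburger
  then have "even (r * (r - 1))" by (simp only: even_mult_iff)
  then have "2 * (r choose 2) = r * (r - 1)" unfolding choose_two by (rule dvd_mult_div_cancel)
  then have "2 * real (r choose 2) = real r * real (r - 1)" by (metis of_nat_mult of_nat_numeral)
  then have two: "real (r choose 2) = real r * (real r - 1) / 2" using assms by (simp add: of_nat_diff)
  have "fact r = real r * fact (r - 1)" using assms by (simp add: fact_reduce)
  then show ?thesis
    unfolding good_colourings_def balanced_value_def of_nat_mult of_nat_fact two by simp
qed

lemma card_PiE_restrict:
  assumes V: "finite V" "S \<subseteq> V" and L: "finite L" and Q: "\<And>c. Q (restrict c S) \<longleftrightarrow> Q c"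
  shows "card {c \<in> V \<rightarrow>\<^sub>E L. Q c} = card {c \<in> S \<rightarrow>\<^sub>E L. Q c} * card L ^ (card V - card S)"
proof -
  let ?ext = "\<lambda>(d, e). \<lambda>v. if v \<in> S then d v else e v"
  have ext: "Q (?ext (d, e)) \<longleftrightarrow> Q d" for d e
  proof -
    have "restrict (?ext (d, e)) S = restrict d S" by (auto simp: restrict_def)
    then show ?thesis using Q by metis
  qed
  have "bij_betw (\<lambda>c. (restrict c S, restrict c (V - S))) {c \<in> V \<rightarrow>\<^sub>E L. Q c}
      ({c \<in> S \<rightarrow>\<^sub>E L. Q c} \<times> ((V - S) \<rightarrow>\<^sub>E L))"
  proof (rule bij_betw_byWitness[where f' = ?ext])
    show "\<forall>c\<in>{c \<in> V \<rightarrow>\<^sub>E L. Q c}. ?ext (restrict c S, restrict c (V - S)) = c"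
      using V(2) by (auto simp: PiE_def extensional_def restrict_def fun_eq_iff)
    show "\<forall>p\<in>{c \<in> S \<rightarrow>\<^sub>E L. Q c} \<times> ((V - S) \<rightarrow>\<^sub>E L). (restrict (?ext p) S, restrict (?ext p) (V - S)) = p"
      by (auto simp: PiE_def extensional_def restrict_def fun_eq_iff)
    show "(\<lambda>c. (restrict c S, restrict c (V - S))) ` {c \<in> V \<rightarrow>\<^sub>E L. Q c}
        \<subseteq> {c \<in> S \<rightarrow>\<^sub>E L. Q c} \<times> ((V - S) \<rightarrow>\<^sub>E L)"
      using V(2) Q by auto
    show "?ext ` ({c \<in> S \<rightarrow>\<^sub>E L. Q c} \<times> ((V - S) \<rightarrow>\<^sub>E L)) \<subseteq> {c \<in> V \<rightarrow>\<^sub>E L. Q c}"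
      using V(2) ext by (auto simp: PiE_def extensional_def Pi_def split: if_splits)
  qed
  then have "card {c \<in> V \<rightarrow>\<^sub>E L. Q c} = card ({c \<in> S \<rightarrow>\<^sub>E L. Q c} \<times> ((V - S) \<rightarrow>\<^sub>E L))"
    by (rule bij_betw_same_card)
  moreover have "card ((V - S) \<rightarrow>\<^sub>E L) = card L ^ (card V - card S)"
    using V by (simp add: card_funcsetE card_Diff_subset finite_subset)
  ultimately show ?thesis by (simp add: card_cartesian_product)
qed

text \<open>
  Average the number of copies over all \<open>l\<close>-colourings of \<open>n\<close> points.
  Every \<open>r\<close>-set is good for the same number of colourings, so the average density is
  the proportion of good colourings of \<open>r\<close> points, and each of the graphs is
  \<open>K\<^sub>k\<close>-free.
\<close>
lemma good_colouring_density_le_max_density: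
  assumes r: "r \<ge> 3" and l: "1 \<le> l" "l < k" and n: "n \<ge> r"
  shows "real (good_colourings r l) / real l ^ r \<le> max_density k (complete_minus_edge r) n"
proof -
  let ?F = "complete_minus_edge r" and ?V = "{..<n}"
  let ?C = "?V \<rightarrow>\<^sub>E {..<l}"
  let ?S = "{S. S \<subseteq> ?V \<and> card S = r}"
  define M where "M = max_density k ?F n"
  have finC: "finite ?C" by (intro finite_PiE) auto
  have finS: "finite ?S" by (rule finite_subset[of _ "Pow ?V"]) auto
  have count: "induced_count ?F (colour_graph ?V c) = card {S \<in> ?S. graph_iso ?F (colour_graph S c)}" for c
    unfolding induced_count_def by (intro arg_cong[where f = card] Collect_cong) (auto simp: induced_colour_graph)
  have le: "real (induced_count ?F (colour_graph ?V c)) \<le> M * real (n choose r)" if c: "c \<in> ?C" for c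
  proof -
    have "\<not> contains_subgraph (colour_graph ?V c) (complete_simple_graph k)"
      using colour_graph_clique_free[OF _ l(2)] c by blast
    then have "induced_density ?F (colour_graph ?V c) \<in> clique_free_densities k ?F n"
      unfolding clique_free_densities_def using simple_colour_graph[of ?V c]
      by (intro CollectI exI[of _ "colour_graph ?V c"]) simp
    then have "induced_density ?F (colour_graph ?V c) \<le> M"
      unfolding M_def max_density_def by (rule Max_ge[OF finite_clique_free_densities])
    moreover have "n choose r > 0" using n by (simp add: zero_less_binomial)
    ultimately show ?thesis by (simp add: induced_density_def field_simps)
  qed
  have "(\<Sum>c\<in>?C. induced_count ?F (colour_graph ?V c))
      = (\<Sum>c\<in>?C. \<Sum>S\<in>?S. if graph_iso ?F (colour_graph S c) then 1 else 0)"
    unfolding count using finS by (simp flip: sum.inter_filter)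
  also have "\<dots> = (\<Sum>S\<in>?S. \<Sum>c\<in>?C. if graph_iso ?F (colour_graph S c) then 1 else 0)"
    by (rule sum.swap)
  also have "\<dots> = (\<Sum>S\<in>?S. good_colourings r l * l ^ (n - r))"
  proof (rule sum.cong[OF refl])
    fix S assume S: "S \<in> ?S"
    then have fS: "finite S" by (auto intro: finite_subset)
    have "(\<Sum>c\<in>?C. if graph_iso ?F (colour_graph S c) then 1 else 0)
        = card {c \<in> ?C. graph_iso ?F (colour_graph S c)}"
      using finC by (simp flip: sum.inter_filter)
    also have "\<dots> = card {c \<in> S \<rightarrow>\<^sub>E {..<l}. graph_iso ?F (colour_graph S c)} * card {..<l} ^ (card ?V - card S)"
    proof (rule card_PiE_restrict)
      show "graph_iso ?F (colour_graph S (restrict c S)) \<longleftrightarrow> graph_iso ?F (colour_graph S c)" for c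
        by (subst colour_graph_cong[of S "restrict c S" c]) auto
    qed (use S in auto)
    also have "\<dots> = good_colourings r l * l ^ (n - r)"
      using card_good_colourings[OF fS _ r, of l] S by simp
    finally show "(\<Sum>c\<in>?C. if graph_iso ?F (colour_graph S c) then 1 else 0)
        = good_colourings r l * l ^ (n - r)" .
  qed
  also have "\<dots> = (n choose r) * (good_colourings r l * l ^ (n - r))"
    by (simp add: n_subsets)
  finally have "real ((n choose r) * (good_colourings r l * l ^ (n - r)))
      = (\<Sum>c\<in>?C. real (induced_count ?F (colour_graph ?V c)))" by (metis of_nat_sum)
  also have "\<dots> \<le> (\<Sum>c\<in>?C. M * real (n choose r))" by (intro sum_mono le)
  also have "\<dots> = real l ^ n * (M * real (n choose r))" by (simp add: card_funcsetE)
  also have "real l ^ n = real l ^ (n - r) * real l ^ r" using n by (simp flip: power_add)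
  finally have "(real (n choose r) * real l ^ (n - r)) * real (good_colourings r l)
      \<le> (real (n choose r) * real l ^ (n - r)) * (M * real l ^ r)" by (simp add: mult_ac)
  moreover have "0 < real (n choose r) * real l ^ (n - r)"
    using n l by (simp add: zero_less_binomial)
  ultimately have "real (good_colourings r l) \<le> M * real l ^ r"
    by (simp only: mult_le_cancel_left_pos)
  then show ?thesis using l by (simp add: M_def field_simps)
qed

section \<open>Density in the balanced multipartite graphon\<close>

text \<open>
  The index of the interval of the balanced partition of \<open>[0,1]\<close> that contains
  \<open>x\<close>.  The last interval is closed, which is why \<open>x = 1\<close> is treated
  separately.  Points outside \<open>[0,1]\<close>, which occur in the sample space with
  probability \<open>0\<close>, get the additional colour \<open>l\<close>.
\<close>
definition interval_colour :: "nat \<Rightarrow> real \<Rightarrow> nat" where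
  "interval_colour l x =
     (if 0 \<le> x \<and> x < 1 then nat \<lfloor>x * real l\<rfloor> else if x = 1 then l - 1 else l)"

lemma part_replicate:
  assumes "i < l"
  shows "part (replicate l (1 / real l)) i =
    (if Suc i = l then {real i / real l..1} else {real i / real l..<real (Suc i) / real l})"
  using assms by (auto simp: part_def min_def sum_list_replicate add_divide_distrib)

lemma part_iff_interval_colour:
  assumes i: "i < l"
  shows "x \<in> part (replicate l (1 / real l)) i \<longleftrightarrow> interval_colour l x = i"
proof -
  have l: "real l > 0" "real i + 1 \<le> real l" using i by simp_all
  have fl: "nat \<lfloor>x * real l\<rfloor> = i \<longleftrightarrow> real i \<le> x * real l \<and> x * real l < real i + 1" if "0 \<le> x"
  proof -
    have "nat \<lfloor>x * real l\<rfloor> = i \<longleftrightarrow> \<lfloor>x * real l\<rfloor> = int i" using that by (auto simp: nat_eq_iff)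
    then show ?thesis by (simp add: floor_eq_iff)
  qed
  have dv: "real i / real l \<le> x \<longleftrightarrow> real i \<le> x * real l" "x < (1 + real i) / real l \<longleftrightarrow> x * real l < real i + 1"
    using l by (simp_all add: field_simps)
  consider "x < 0" | "0 \<le> x" "x < 1" | "x = 1" | "x > 1" by linarith
  then show ?thesis
  proof cases
    case 1
    then have "x * real l < 0" using l by (simp add: mult_neg_pos)
    then have "\<not> real i \<le> x * real l" by linarith
    then show ?thesis using 1 i by (simp add: part_replicate interval_colour_def dv)
  next
    case 2
    have "x * real l < real l" using 2 l by simp
    then have "Suc i = l \<Longrightarrow> x * real l < real i + 1" using i by linarith
    then show ?thesis using 2 i by (auto simp: part_replicate interval_colour_def dv fl)
  next
    case 3
    have "real i / real l \<le> 1" "1 < real (Suc i) / real l \<longleftrightarrow> l < Suc i" using l by (simp_all add: field_simps)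
    then show ?thesis using 3 i by (auto simp: part_replicate interval_colour_def)
  next
    case 4
    then have "1 * real l < x * real l" using l by (intro mult_strict_right_mono) auto
    then have "\<not> x * real l < real i + 1" using l by linarith
    then show ?thesis using 4 i by (simp add: part_replicate interval_colour_def dv)
  qed
qed

lemma interval_colour_outside:
  assumes "l \<ge> 1"
  shows "interval_colour l x = l \<longleftrightarrow> x \<notin> {0..1}"
proof -
  have "nat \<lfloor>x * real l\<rfloor> \<noteq> l" if "0 \<le> x" "x < 1"
  proof -
    have "x * real l < real l" using that assms by simp
    then have "\<lfloor>x * real l\<rfloor> < int l" by (simp add: floor_less_iff)
    then show ?thesis using assms by linarith
  qed
  then show ?thesis using assms by (auto simp: interval_colour_def)
qed

lemma interval_colour_le:
  assumes "l \<ge> 1"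
  shows "interval_colour l x \<le> l"
proof -
  have "nat \<lfloor>x * real l\<rfloor> \<le> l" if "0 \<le> x" "x < 1"
  proof -
    have "x * real l < real l" using that assms by simp
    then have "\<lfloor>x * real l\<rfloor> < int l" by (simp add: floor_less_iff)
    then show ?thesis by linarith
  qed
  then show ?thesis by (auto simp: interval_colour_def)
qed

text \<open>
  Vertices of colour \<open>l\<close> are isolated, just as the graphon vanishes outside the unit
  square.
\<close>
definition partial_colour_graph :: "nat \<Rightarrow> nat \<Rightarrow> (nat \<Rightarrow> nat) \<Rightarrow> nat graph" where
  "partial_colour_graph l n c =
     ({..<n}, {{i, j} | i j. i < n \<and> j < n \<and> i \<noteq> j \<and> c i < l \<and> c j < l \<and> c i \<noteq> c j})"

lemma partial_colour_graph_cong: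
  "(\<And>i. i < n \<Longrightarrow> c i = d i) \<Longrightarrow> partial_colour_graph l n c = partial_colour_graph l n d"
proof -
  assume cd: "\<And>i. i < n \<Longrightarrow> c i = d i"
  have "(i < n \<and> j < n \<and> i \<noteq> j \<and> c i < l \<and> c j < l \<and> c i \<noteq> c j) \<longleftrightarrow>
      (i < n \<and> j < n \<and> i \<noteq> j \<and> d i < l \<and> d j < l \<and> d i \<noteq> d j)" for i j
    using cd[of i] cd[of j] by auto
  then show ?thesis by (simp only: partial_colour_graph_def)
qed

lemma partial_colour_graph_total:
  assumes "c \<in> {..<n} \<rightarrow> {..<l}"
  shows "partial_colour_graph l n c = colour_graph {..<n} c"
proof -
  have "c i < l" if "i < n" for i using assms that by auto
  then have "(i < n \<and> j < n \<and> i \<noteq> j \<and> c i < l \<and> c j < l \<and> c i \<noteq> c j) \<longleftrightarrow>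
      (i \<in> {..<n} \<and> j \<in> {..<n} \<and> c i \<noteq> c j)" for i j
    by (cases "i = j") auto
  then show ?thesis by (simp only: partial_colour_graph_def colour_graph_def)
qed

lemma sampled_graph_eq:
  "sampled_graph (multipartite_graphon (replicate l (1 / real l))) n \<omega>
    = partial_colour_graph l n (\<lambda>i. interval_colour l (\<omega> i))"
proof -
  have "multipartite_graphon (replicate l (1 / real l)) x y = 1 \<longleftrightarrow>
      interval_colour l x < l \<and> interval_colour l y < l \<and> interval_colour l x \<noteq> interval_colour l y" for x y
    unfolding multipartite_graphon_def using part_iff_interval_colour[of _ l] by auto
  then show ?thesis unfolding sampled_graph_def partial_colour_graph_def by simp
qed

lemma measure_interval_colour:
  assumes l: "l \<ge> 1" and i: "i \<le> l"
  defines "B \<equiv> {x. interval_colour l x = i}"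
  shows "B \<in> sets borel"
    "measure (uniform_measure lborel {0..1}) B = (if i < l then 1 / real l else 0)"
proof -
  have B: "B = (if i < l then part (replicate l (1 / real l)) i else - {0..1})"
    using part_iff_interval_colour[of i l] interval_colour_outside[OF l] i by (auto simp: B_def)
  show sets: "B \<in> sets borel" unfolding B by (auto simp: part_replicate)
  have m: "measure (uniform_measure lborel {0..1}) B = measure lborel ({0..1} \<inter> B)"
    using sets by (subst measure_uniform_measure) auto
  show "measure (uniform_measure lborel {0..1}) B = (if i < l then 1 / real l else 0)"
  proof (cases "i < l")
    case True
    have "interval_colour l x = i \<Longrightarrow> x \<in> {0..1}" for x
      using interval_colour_outside[OF l, of x] True by auto
    then have "{0..1} \<inter> B = B" unfolding B_def by blast
    then have "{0..1} \<inter> B = part (replicate l (1 / real l)) i" using B True by simp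
    moreover have "real (Suc i) / real l = real i / real l + 1 / real l" by (simp add: add_divide_distrib)
    moreover have "1 = real i / real l + 1 / real l" if "Suc i = l" using that l by (simp add: field_simps)
    ultimately show ?thesis using True m by (auto simp: part_replicate)
  qed (use B m in simp)
qed

text \<open>
  The event depends only on the colours of the points, so it is a finite disjoint union of boxes,
  one for each colouring whose graph is a copy of \<open>F\<close>.  This makes it measurable; a
  box that uses the colour \<open>l\<close> is a null set, and every other box has measure
  \<open>1 / l\<^sup>n\<close>.
\<close>
lemma graphon_density_balanced:
  assumes n: "n = card (verts F)" and l: "l \<ge> 1"
  shows "graphon_induced_density F (multipartite_graphon (replicate l (1 / real l)))
    = real (card {c \<in> {..<n} \<rightarrow>\<^sub>E {..<l}. graph_iso F (colour_graph {..<n} c)}) / real l ^ n"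
proof -
  let ?M = "uniform_measure lborel {0..1::real}"
  let ?B = "\<lambda>i. {x. interval_colour l x = i}"
  let ?C = "{c \<in> {..<n} \<rightarrow>\<^sub>E {..l}. graph_iso F (partial_colour_graph l n c)}"
  let ?D = "{c \<in> {..<n} \<rightarrow>\<^sub>E {..<l}. graph_iso F (colour_graph {..<n} c)}"
  let ?box = "\<lambda>c. Pi\<^sub>E {..<n} (\<lambda>i. ?B (c i))"
  interpret prob_space ?M by (rule prob_space_uniform_measure) auto
  interpret P: finite_product_prob_space "\<lambda>_. ?M" "{..<n}" by unfold_locales auto
  have fC: "finite ?C"
    using finite_PiE[of "{..<n}" "\<lambda>_. {..l}"] by simp
  have event: "{\<omega> \<in> space (uniform_points n). graph_iso F
      (sampled_graph (multipartite_graphon (replicate l (1 / real l))) n \<omega>)} = (\<Union>c\<in>?C. ?box c)"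
  proof (intro equalityI subsetI)
    fix \<omega> assume w: "\<omega> \<in> {\<omega> \<in> space (uniform_points n). graph_iso F
      (sampled_graph (multipartite_graphon (replicate l (1 / real l))) n \<omega>)}"
    define c where "c = restrict (\<lambda>i. interval_colour l (\<omega> i)) {..<n}"
    have "partial_colour_graph l n (\<lambda>i. interval_colour l (\<omega> i)) = partial_colour_graph l n c"
      by (rule partial_colour_graph_cong) (simp add: c_def)
    then have "c \<in> ?C" using w interval_colour_le[OF l] by (auto simp: sampled_graph_eq c_def)
    moreover have "\<omega> \<in> ?box c"
      using w by (auto simp: uniform_points_def space_PiM c_def PiE_iff)
    ultimately show "\<omega> \<in> (\<Union>c\<in>?C. ?box c)" by blast
  next
    fix \<omega> assume "\<omega> \<in> (\<Union>c\<in>?C. ?box c)"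
    then obtain c where c: "c \<in> ?C" "\<omega> \<in> ?box c" by blast
    have "partial_colour_graph l n (\<lambda>i. interval_colour l (\<omega> i)) = partial_colour_graph l n c"
      by (rule partial_colour_graph_cong) (use c(2) in \<open>auto simp: PiE_iff\<close>)
    then show "\<omega> \<in> {\<omega> \<in> space (uniform_points n). graph_iso F
        (sampled_graph (multipartite_graphon (replicate l (1 / real l))) n \<omega>)}"
      using c by (auto simp: sampled_graph_eq uniform_points_def space_PiM PiE_iff)
  qed
  have le: "c i \<le> l" if "c \<in> ?C" "i < n" for c i using that by (auto simp: PiE_iff)
  have disj: "disjoint_family_on ?box ?C"
    unfolding disjoint_family_on_def
  proof (intro ballI impI, rule ccontr)
    fix c d assume cd: "c \<in> ?C" "d \<in> ?C" "c \<noteq> d" "?box c \<inter> ?box d \<noteq> {}"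
    obtain \<omega> where w: "\<omega> \<in> ?box c \<inter> ?box d" using cd(4) by (meson all_not_in_conv)
    have "c i = d i" if "i \<in> {..<n}" for i
      using PiE_mem[OF IntD1[OF w] that] PiE_mem[OF IntD2[OF w] that] by simp
    moreover have "c \<in> {..<n} \<rightarrow>\<^sub>E {..l}" "d \<in> {..<n} \<rightarrow>\<^sub>E {..l}" using cd by simp_all
    ultimately have "c = d" by (intro PiE_ext) auto
    with cd(3) show False by simp
  qed
  have box: "?box c \<in> sets (PiM {..<n} (\<lambda>_. ?M))"
    "measure (PiM {..<n} (\<lambda>_. ?M)) (?box c) = (if c \<in> ?D then 1 / real l ^ n else 0)"
    if c: "c \<in> ?C" for c
  proof -
    have sets: "?B (c i) \<in> sets ?M" if "i \<in> {..<n}" for i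
      using measure_interval_colour(1)[OF l le[OF c]] that by simp
    then show "?box c \<in> sets (PiM {..<n} (\<lambda>_. ?M))" by (intro sets_PiM_I_finite) auto
    have "measure (PiM {..<n} (\<lambda>_. ?M)) (?box c) = (\<Prod>i<n. measure ?M (?B (c i)))"
      by (rule P.finite_measure_PiM_emb) (rule sets)
    also have "\<dots> = (\<Prod>i<n. if c i < l then 1 / real l else 0)"
      using measure_interval_colour(2)[OF l le[OF c]] by (intro prod.cong) auto
    also have "\<dots> = (if c \<in> ?D then 1 / real l ^ n else 0)"
    proof (cases "\<forall>i<n. c i < l")
      case True
      then have E: "c \<in> {..<n} \<rightarrow>\<^sub>E {..<l}" using c by (auto simp: PiE_iff)
      then have "c \<in> {..<n} \<rightarrow> {..<l}" by (simp add: PiE_iff Pi_iff)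
      from partial_colour_graph_total[OF this] have "c \<in> ?D" using c E by simp
      moreover have "(\<Prod>i<n. if c i < l then 1 / real l else 0) = (\<Prod>i<n. 1 / real l)"
        using True by (intro prod.cong) auto
      ultimately show ?thesis by (simp add: power_divide)
    next
      case False
      then obtain i where i: "i < n" "\<not> c i < l" by blast
      then have "(\<Prod>i<n. if c i < l then 1 / real l else 0) = 0"
        by (intro prod_zero) (auto intro!: bexI[of _ i])
      moreover have "c \<notin> ?D" using i by (auto simp: PiE_iff)
      ultimately show ?thesis by (simp only: if_False)
    qed
    finally show "measure (PiM {..<n} (\<lambda>_. ?M)) (?box c) = (if c \<in> ?D then 1 / real l ^ n else 0)" .
  qed
  have sub: "?D \<subseteq> ?C"
  proof
    fix c assume c: "c \<in> ?D"
    then have "c \<in> {..<n} \<rightarrow> {..<l}" by (simp add: PiE_iff Pi_iff)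
    moreover have "c \<in> {..<n} \<rightarrow>\<^sub>E {..l}" using c by (simp add: PiE_iff less_imp_le)
    ultimately show "c \<in> ?C" using c partial_colour_graph_total[of c n l] by simp
  qed
  have "graphon_induced_density F (multipartite_graphon (replicate l (1 / real l)))
      = measure (PiM {..<n} (\<lambda>_. ?M)) (\<Union>c\<in>?C. ?box c)"
    unfolding graphon_induced_density_def Let_def n[symmetric] event by (simp add: uniform_points_def)
  also have "\<dots> = (\<Sum>c\<in>?C. measure (PiM {..<n} (\<lambda>_. ?M)) (?box c))"
    using fC box(1) disj by (intro P.finite_measure_finite_Union) auto
  also have "\<dots> = (\<Sum>c\<in>?C. if c \<in> ?D then 1 / real l ^ n else 0)"
    by (intro sum.cong refl box(2))
  also have "\<dots> = (\<Sum>c\<in>?D. 1 / real l ^ n)"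
    using sum.inter_restrict[OF fC, of "\<lambda>_. 1 / real l ^ n" ?D] sub by (simp add: Int_absorb1)
  finally show ?thesis by simp
qed

section \<open>The inducibility\<close>

lemma binomial_over_power_tendsto:
  "(\<lambda>n. real (n choose r) / real n ^ r) \<longlonglongrightarrow> 1 / fact r"
proof -
  have "(\<lambda>n. 1 - real i / real n) \<longlonglongrightarrow> 1" for i
    using tendsto_diff[OF tendsto_const lim_const_over_n, of 1 "real i"] by simp
  then have "(\<lambda>n. \<Prod>i = 0..<r. 1 - real i / real n) \<longlonglongrightarrow> (\<Prod>i = 0..<r. 1)"
    by (intro tendsto_prod)
  then have "(\<lambda>n. (\<Prod>i = 0..<r. 1 - real i / real n) / fact r) \<longlonglongrightarrow> 1 / fact r"
    by (intro tendsto_divide tendsto_const) auto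
  moreover have "\<forall>\<^sub>F n in sequentially.
      (\<Prod>i = 0..<r. 1 - real i / real n) / fact r = real (n choose r) / real n ^ r"
    using eventually_gt_at_top[of 0]
  proof eventually_elim
    fix n :: nat assume n: "n > 0"
    have "real (n choose r) * fact r = (\<Prod>i = 0..<r. real n - real i)"
      by (simp add: binomial_gbinomial gbinomial_mult_fact')
    also have "\<dots> = (\<Prod>i = 0..<r. real n * (1 - real i / real n))"
      using n by (intro prod.cong) (auto simp: field_simps)
    also have "\<dots> = real n ^ r * (\<Prod>i = 0..<r. 1 - real i / real n)" by (simp add: prod.distrib)
    finally show "(\<Prod>i = 0..<r. 1 - real i / real n) / fact r = real (n choose r) / real n ^ r"
      using n by (simp add: field_simps)
  qed
  ultimately show ?thesis by (rule Lim_transform_eventually)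
qed

lemma max_density_le:
  assumes r: "r \<ge> 3" and k: "k \<ge> 2" and n: "n \<ge> r"
    and M: "\<And>l. 1 \<le> l \<Longrightarrow> l < k \<Longrightarrow> balanced_value r l \<le> M"
  shows "max_density k (complete_minus_edge r) n \<le> M / 2 / (real (n choose r) / real n ^ r)"
  unfolding max_density_def
proof (rule Max.boundedI[OF finite_clique_free_densities clique_free_densities_nonempty[OF k]])
  fix d assume "d \<in> clique_free_densities k (complete_minus_edge r) n"
  then obtain G :: "nat graph" where G: "simple_graph G" "card (verts G) = n"
      "\<not> contains_subgraph G (complete_simple_graph k)"
    and d: "d = induced_density (complete_minus_edge r) G"
    unfolding clique_free_densities_def by blast
  have "verts G \<noteq> {}" using G(2) n r by auto
  then obtain l where l: "1 \<le> l" "l < k"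
    "2 * real (induced_count (complete_minus_edge r) G) \<le> real n ^ r * balanced_value r l"
    using induced_count_le_balanced[OF G(1) _ G(3) r] G(2) by metis
  have "real n ^ r * balanced_value r l \<le> real n ^ r * M"
    using M[OF l(1,2)] by (intro mult_left_mono) auto
  then have "2 * real (induced_count (complete_minus_edge r) G) \<le> real n ^ r * M"
    using l(3) by linarith
  moreover have "0 < real (n choose r)" "0 < real n ^ r"
    using n r by (simp_all add: zero_less_binomial)
  ultimately show "d \<le> M / 2 / (real (n choose r) / real n ^ r)"
    using G(2) by (simp add: d induced_density_def field_simps)
qed

lemma inducibility_complete_minus_edge:
  assumes r: "r \<ge> 3" and l: "1 \<le> l" "l < k"
    and opt: "\<And>l'. 1 \<le> l' \<Longrightarrow> l' < k \<Longrightarrow> balanced_value r l' \<le> balanced_value r l"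
  shows "inducibility k (complete_minus_edge r) = fact r / 2 * balanced_value r l"
proof -
  let ?D = "fact r / 2 * balanced_value r l"
  have k: "k \<ge> 2" using l by simp
  have "(\<lambda>n. balanced_value r l / 2 / (real (n choose r) / real n ^ r))
      \<longlonglongrightarrow> balanced_value r l / 2 / (1 / fact r)"
    by (intro tendsto_divide tendsto_const binomial_over_power_tendsto) simp
  then have up: "(\<lambda>n. balanced_value r l / 2 / (real (n choose r) / real n ^ r)) \<longlonglongrightarrow> ?D"
    by (simp add: mult.commute)
  have "(\<lambda>n. max_density k (complete_minus_edge r) n) \<longlonglongrightarrow> ?D"
  proof (rule tendsto_sandwich[OF _ _ tendsto_const up])
    show "\<forall>\<^sub>F n in sequentially. ?D \<le> max_density k (complete_minus_edge r) n"
      using eventually_ge_at_top[of r]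
    proof eventually_elim
      fix n assume "r \<le> n"
      then show "?D \<le> max_density k (complete_minus_edge r) n"
        using good_colouring_density_le_max_density[OF r l] good_colourings_balanced_value[of r l] r
        by simp
    qed
    show "\<forall>\<^sub>F n in sequentially. max_density k (complete_minus_edge r) n
        \<le> balanced_value r l / 2 / (real (n choose r) / real n ^ r)"
      using eventually_ge_at_top[of r] by eventually_elim (rule max_density_le[OF r k _ opt])
  qed
  then show ?thesis unfolding inducibility_def by (rule limI)
qed

lemma inducibility_attained_by_balanced:
  assumes r: "r \<ge> 3" and l: "1 \<le> l" "l < k"
    and opt: "\<And>l'. 1 \<le> l' \<Longrightarrow> l' < k \<Longrightarrow> balanced_value r l' \<le> balanced_value r l"
  shows "inducibility_attained_by k (complete_minus_edge r)
    (multipartite_graphon (replicate l (1 / real l)))"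
proof -
  have "graphon_induced_density (complete_minus_edge r) (multipartite_graphon (replicate l (1 / real l)))
      = real (good_colourings r l) / real l ^ r"
    using graphon_density_balanced[of r "complete_minus_edge r" l] card_good_colourings[of "{..<r}" r l] r l
    by simp
  then show ?thesis
    using inducibility_complete_minus_edge[OF r l opt] good_colourings_balanced_value[of r l] r
    unfolding inducibility_attained_by_def by simp
qed

theorem theorem1p5:
  fixes r k t :: nat
  assumes "r \<ge> 3" and "k \<ge> 3"
    and "int t = \<lceil>(real r - 2) * (3 * real r + 1) / 6\<rceil>"
  shows "(k \<le> t + 1 \<longrightarrow>
            inducibility_attained_by k (complete_minus_edge r)
              (multipartite_graphon (replicate (k - 1) (1 / real (k - 1))))) \<and>
         (k > t + 1 \<longrightarrow>
            inducibility_attained_by k (complete_minus_edge r)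
              (multipartite_graphon (replicate t (1 / real t))))"
proof -
  have "0 < (real r - 2) * (3 * real r + 1) / 6" using assms(1) by simp
  then have "0 < int t" unfolding assms(3) by (simp only: zero_less_ceiling)
  then have m: "1 \<le> min (k - 1) t" "min (k - 1) t < k" using assms(2) by auto
  have "balanced_value r l \<le> balanced_value r (min (k - 1) t)" if "1 \<le> l" "l < k" for l
    using balanced_value_le_optimum[OF assms(1,3) that(1), of "k - 1"] that(2) by simp
  from inducibility_attained_by_balanced[OF assms(1) m this]
  have att: "inducibility_attained_by k (complete_minus_edge r)
    (multipartite_graphon (replicate (min (k - 1) t) (1 / real (min (k - 1) t))))" .
  show ?thesis
  proof (intro conjI impI)
    assume "k \<le> t + 1"
    then have "min (k - 1) t = k - 1" by simp
    then show "inducibility_attained_by k (complete_minus_edge r)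
        (multipartite_graphon (replicate (k - 1) (1 / real (k - 1))))" using att by simp
  next
    assume "k > t + 1"
    then have "min (k - 1) t = t" by simp
    then show "inducibility_attained_by k (complete_minus_edge r)
        (multipartite_graphon (replicate t (1 / real t)))" using att by simp
  qed
qed

end
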